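(* Let $\ell\in\tfrac12+\mathbb{N}_0$ with $\ell\ge\tfrac32$, and let $\mathfrak{g}=\widehat{\mathfrak{cga}}_\ell(2,\mathbb{C})$ be the mass central extension of the complex conformal Galilei algebra with $d=2$. Then $H^2(\mathfrak{g},\mathfrak{g})\cong\mathbb{C}$.
   Context: $\mathbb{N}_0=\{0,1,2,\dots\}$. For $\ell\in\frac12+\mathbb{N}_0$, the mass central extension $\widehat{\mathfrak{cga}}_\ell(2,\mathbb{C})$ is the complex Lie algebra of dimension $4\ell+7$ with basis $C,D,H,M_{1,2}$, $P_i,Q_i$ ($0\le i\le 2\ell$), and a central element $M$, with non-trivial brackets \begin{align*} [D,H]&=2H,\quad [C,H]=D,\quad [D,C]=-2C,\\ [M_{1,2},P_i]&=-Q_i,\quad [M_{1,2},Q_i]=P_i,\\ [H,P_i]&=-iP_{i-1},\quad [D,P_i]=2(\ell-i)P_i,\quad [C,P_i]=(2\ell-i)P_{i+1},\\ [H,Q_i]&=-iQ_{i-1},\quad [D,Q_i]=2(\ell-i)Q_i,\quad [C,Q_i]=(2\ell-i)Q_{i+1},\\ [P_m,P_{2\ell-m}]&=b_mM,\quad [Q_m,Q_{2\ell-m}]=b_mM,\qquad b_m=(-1)^{m+\ell+\frac12}(2\ell-m)!\,m!. \end{align*} All other brackets of basis elements (not following by antisymmetry) vanish. $H^2(\mathfrak{g},\mathfrak{g})$ is the second Chevalley–Eilenberg cohomology space of $\mathfrak{g}$ with coefficients in the adjoint module. *)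

theory Defs
  imports Complex_Main "HOL-Library.Function_Algebras" "HOL-Library.Set_Algebras"
begin

section \<open>Second Chevalley--Eilenberg cohomology with adjoint coefficients\<close>

text \<open>
  A finite-dimensional complex Lie algebra is given by a subspace \<open>V\<close> of a function space
  \<open>'i \<Rightarrow> complex\<close> (addition and zero are pointwise) and a bracket \<open>br\<close> that is used on \<open>V\<close> only.
\<close>

definition vscale :: "complex \<Rightarrow> ('i \<Rightarrow> complex) \<Rightarrow> ('i \<Rightarrow> complex)" where
  "vscale c x = (\<lambda>i. c * x i)"

definition linear_on :: "('i \<Rightarrow> complex) set \<Rightarrow> (('i \<Rightarrow> complex) \<Rightarrow> ('j \<Rightarrow> complex)) \<Rightarrow> bool" where
  "linear_on V f \<longleftrightarrow>
     (\<forall>x\<in>V. \<forall>y\<in>V. f (x + y) = f x + f y) \<and> (\<forall>c. \<forall>x\<in>V. f (vscale c x) = vscale c (f x))"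

text \<open>
  Cochains are maps on \<open>V\<close>. They are represented by functions on the whole type that vanish
  outside \<open>V\<close>, so that equal cochains are equal functions.
\<close>

definition C1 :: "('i \<Rightarrow> complex) set \<Rightarrow> (('i \<Rightarrow> complex) \<Rightarrow> ('i \<Rightarrow> complex)) set" where
  "C1 V = {f. linear_on V f \<and> (\<forall>x\<in>V. f x \<in> V) \<and> (\<forall>x. x \<notin> V \<longrightarrow> f x = 0)}"

definition C2 ::
  "('i \<Rightarrow> complex) set \<Rightarrow> (('i \<Rightarrow> complex) \<Rightarrow> ('i \<Rightarrow> complex) \<Rightarrow> ('i \<Rightarrow> complex)) set" where
  "C2 V = {\<omega>. (\<forall>x\<in>V. linear_on V (\<omega> x)) \<and> (\<forall>y\<in>V. linear_on V (\<lambda>x. \<omega> x y)) \<and>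
              (\<forall>x\<in>V. \<omega> x x = 0) \<and> (\<forall>x\<in>V. \<forall>y\<in>V. \<omega> x y \<in> V) \<and>
              (\<forall>x y. x \<notin> V \<or> y \<notin> V \<longrightarrow> \<omega> x y = 0)}"

definition d1 ::
  "('i \<Rightarrow> complex) set \<Rightarrow> (('i \<Rightarrow> complex) \<Rightarrow> ('i \<Rightarrow> complex) \<Rightarrow> ('i \<Rightarrow> complex)) \<Rightarrow>
   (('i \<Rightarrow> complex) \<Rightarrow> ('i \<Rightarrow> complex)) \<Rightarrow> ('i \<Rightarrow> complex) \<Rightarrow> ('i \<Rightarrow> complex) \<Rightarrow> ('i \<Rightarrow> complex)" where
  "d1 V br f = (\<lambda>x y. if x \<in> V \<and> y \<in> V then br x (f y) - br y (f x) - f (br x y) else 0)"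

definition d2 ::
  "('i \<Rightarrow> complex) set \<Rightarrow> (('i \<Rightarrow> complex) \<Rightarrow> ('i \<Rightarrow> complex) \<Rightarrow> ('i \<Rightarrow> complex)) \<Rightarrow>
   (('i \<Rightarrow> complex) \<Rightarrow> ('i \<Rightarrow> complex) \<Rightarrow> ('i \<Rightarrow> complex)) \<Rightarrow>
   ('i \<Rightarrow> complex) \<Rightarrow> ('i \<Rightarrow> complex) \<Rightarrow> ('i \<Rightarrow> complex) \<Rightarrow> ('i \<Rightarrow> complex)" where
  "d2 V br \<omega> = (\<lambda>x y z. if x \<in> V \<and> y \<in> V \<and> z \<in> V then
       br x (\<omega> y z) - br y (\<omega> x z) + br z (\<omega> x y)
       - \<omega> (br x y) z + \<omega> (br x z) y - \<omega> (br y z) x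
     else 0)"

definition Z2 ::
  "('i \<Rightarrow> complex) set \<Rightarrow> (('i \<Rightarrow> complex) \<Rightarrow> ('i \<Rightarrow> complex) \<Rightarrow> ('i \<Rightarrow> complex)) \<Rightarrow>
   (('i \<Rightarrow> complex) \<Rightarrow> ('i \<Rightarrow> complex) \<Rightarrow> ('i \<Rightarrow> complex)) set" where
  "Z2 V br = {\<omega> \<in> C2 V. d2 V br \<omega> = 0}"

definition B2 ::
  "('i \<Rightarrow> complex) set \<Rightarrow> (('i \<Rightarrow> complex) \<Rightarrow> ('i \<Rightarrow> complex) \<Rightarrow> ('i \<Rightarrow> complex)) \<Rightarrow>
   (('i \<Rightarrow> complex) \<Rightarrow> ('i \<Rightarrow> complex) \<Rightarrow> ('i \<Rightarrow> complex)) set" where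
  "B2 V br = d1 V br ` C1 V"

text \<open>
  The quotient \<open>Z2 / B2\<close> as a set of cosets. Cosets are added with the set addition of
  \<^theory>\<open>HOL-Library.Set_Algebras\<close>; in the scalar multiplication the summand \<open>B2 V br\<close> only
  matters for \<open>c = 0\<close>, where the elementwise multiple of a coset is \<open>{0}\<close> instead of \<open>B2 V br\<close>.
\<close>

definition H2 ::
  "('i \<Rightarrow> complex) set \<Rightarrow> (('i \<Rightarrow> complex) \<Rightarrow> ('i \<Rightarrow> complex) \<Rightarrow> ('i \<Rightarrow> complex)) \<Rightarrow>
   (('i \<Rightarrow> complex) \<Rightarrow> ('i \<Rightarrow> complex) \<Rightarrow> ('i \<Rightarrow> complex)) set set" where
  "H2 V br = (\<lambda>\<omega>. \<omega> +o B2 V br) ` Z2 V br"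

definition H2_scale ::
  "('i \<Rightarrow> complex) set \<Rightarrow> (('i \<Rightarrow> complex) \<Rightarrow> ('i \<Rightarrow> complex) \<Rightarrow> ('i \<Rightarrow> complex)) \<Rightarrow> complex \<Rightarrow>
   (('i \<Rightarrow> complex) \<Rightarrow> ('i \<Rightarrow> complex) \<Rightarrow> ('i \<Rightarrow> complex)) set \<Rightarrow>
   (('i \<Rightarrow> complex) \<Rightarrow> ('i \<Rightarrow> complex) \<Rightarrow> ('i \<Rightarrow> complex)) set" where
  "H2_scale V br c X = (\<lambda>\<omega> x y. vscale c (\<omega> x y)) ` X + B2 V br"

definition linear_isomorphic ::
  "'a::plus set \<Rightarrow> (complex \<Rightarrow> 'a \<Rightarrow> 'a) \<Rightarrow> 'b::plus set \<Rightarrow> (complex \<Rightarrow> 'b \<Rightarrow> 'b) \<Rightarrow> bool" where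
  "linear_isomorphic A sA B sB \<longleftrightarrow>
     (\<exists>\<phi>. bij_betw \<phi> A B \<and> (\<forall>x\<in>A. \<forall>y\<in>A. \<phi> (x + y) = \<phi> x + \<phi> y) \<and>
          (\<forall>c. \<forall>x\<in>A. \<phi> (sA c x) = sB c (\<phi> x)))"


section \<open>The mass central extension of the conformal Galilei algebra for d = 2\<close>

datatype cga_gen = gC | gD | gH | gM12 | gP nat | gQ nat | gM

definition bvec :: "cga_gen \<Rightarrow> (cga_gen \<Rightarrow> complex)" where
  "bvec g = (\<lambda>h. if h = g then 1 else 0)"

definition twice :: "real \<Rightarrow> nat" where
  "twice l = nat \<lfloor>2 * l\<rfloor>"

definition cga_basis :: "real \<Rightarrow> cga_gen set" where
  "cga_basis l = {gC, gD, gH, gM12, gM} \<union> gP ` {0..twice l} \<union> gQ ` {0..twice l}"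

definition cga_b :: "real \<Rightarrow> nat \<Rightarrow> complex" where
  "cga_b l m = (-1) ^ nat \<lfloor>real m + l + 1/2\<rfloor> * fact (twice l - m) * fact m"

text \<open>
  In the brackets with \<open>gH\<close> and \<open>gC\<close> the meaningless generators \<open>P\<^sub>-\<^sub>1\<close> and
  \<open>P\<^bsub>2l+1\<^esub>\<close> (and likewise for \<open>Q\<close>) come with coefficient 0.
\<close>

fun cga_gen_bracket :: "real \<Rightarrow> cga_gen \<Rightarrow> cga_gen \<Rightarrow> (cga_gen \<Rightarrow> complex)" where
  "cga_gen_bracket l gD gH = vscale 2 (bvec gH)"
| "cga_gen_bracket l gH gD = vscale (-2) (bvec gH)"
| "cga_gen_bracket l gC gH = bvec gD"
| "cga_gen_bracket l gH gC = - bvec gD"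
| "cga_gen_bracket l gD gC = vscale (-2) (bvec gC)"
| "cga_gen_bracket l gC gD = vscale 2 (bvec gC)"
| "cga_gen_bracket l gM12 (gP i) = - bvec (gQ i)"
| "cga_gen_bracket l (gP i) gM12 = bvec (gQ i)"
| "cga_gen_bracket l gM12 (gQ i) = bvec (gP i)"
| "cga_gen_bracket l (gQ i) gM12 = - bvec (gP i)"
| "cga_gen_bracket l gH (gP i) = vscale (- of_nat i) (bvec (gP (i - 1)))"
| "cga_gen_bracket l (gP i) gH = vscale (of_nat i) (bvec (gP (i - 1)))"
| "cga_gen_bracket l gD (gP i) = vscale (of_real (2 * (l - real i))) (bvec (gP i))"
| "cga_gen_bracket l (gP i) gD = vscale (- of_real (2 * (l - real i))) (bvec (gP i))"
| "cga_gen_bracket l gC (gP i) = vscale (of_real (2 * l - real i)) (bvec (gP (i + 1)))"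
| "cga_gen_bracket l (gP i) gC = vscale (- of_real (2 * l - real i)) (bvec (gP (i + 1)))"
| "cga_gen_bracket l gH (gQ i) = vscale (- of_nat i) (bvec (gQ (i - 1)))"
| "cga_gen_bracket l (gQ i) gH = vscale (of_nat i) (bvec (gQ (i - 1)))"
| "cga_gen_bracket l gD (gQ i) = vscale (of_real (2 * (l - real i))) (bvec (gQ i))"
| "cga_gen_bracket l (gQ i) gD = vscale (- of_real (2 * (l - real i))) (bvec (gQ i))"
| "cga_gen_bracket l gC (gQ i) = vscale (of_real (2 * l - real i)) (bvec (gQ (i + 1)))"
| "cga_gen_bracket l (gQ i) gC = vscale (- of_real (2 * l - real i)) (bvec (gQ (i + 1)))"
| "cga_gen_bracket l (gP m) (gP k) = (if m + k = twice l then vscale (cga_b l m) (bvec gM) else 0)"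
| "cga_gen_bracket l (gQ m) (gQ k) = (if m + k = twice l then vscale (cga_b l m) (bvec gM) else 0)"
| "cga_gen_bracket l _ _ = 0"

definition cga_hat :: "real \<Rightarrow> (cga_gen \<Rightarrow> complex) set" where
  "cga_hat l = {x. \<forall>g. g \<notin> cga_basis l \<longrightarrow> x g = 0}"

definition cga_bracket ::
  "real \<Rightarrow> (cga_gen \<Rightarrow> complex) \<Rightarrow> (cga_gen \<Rightarrow> complex) \<Rightarrow> (cga_gen \<Rightarrow> complex)" where
  "cga_bracket l x y =
     (\<Sum>g\<in>cga_basis l. \<Sum>h\<in>cga_basis l. vscale (x g * y h) (cga_gen_bracket l g h))"

end

theory Submission
  imports Defs
begin

text \<open>
  Write \<open>n = 2 l\<close>, an odd number \<open>\<ge> 3\<close>. The algebra \<open>\<gg>\<close> is the semidirect product of the Levi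
  part \<open>sl\<^sub>2 = \<langle>C, D, H\<rangle>\<close> and the rotation \<open>R = M\<^sub>1\<^sub>2\<close> with a Heisenberg algebra that has centre
  \<open>M\<close>. The vectors \<open>X\<^sup>s\<^sub>k = P\<^sub>k + s Q\<^sub>k\<close> with \<open>s = \<i>\<close> or \<open>s = - \<i>\<close> are eigenvectors of \<open>D\<close> and of
  \<open>R\<close>. For fixed \<open>s\<close> they span an irreducible \<open>sl\<^sub>2\<close>-module of dimension \<open>n + 1\<close>, and the bracket
  pairs the two modules with values in the line of \<open>M\<close>.

  The nonzero class is visible on the pair \<open>(R, M)\<close>. Assigning the degrees 1 to \<open>P, Q\<close>, 2 to \<open>M\<close>
  and 0 to the rest gives a derivation, and adding a multiple of it to the action of \<open>R\<close> deforms
  the algebra. Let \<open>\<tau> \<omega>\<close> be the coefficient of \<open>M\<close> in \<open>\<omega> (R, M)\<close>. It vanishes on coboundaries,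
  because \<open>M\<close> is central and does not occur in any bracket with \<open>R\<close> (lemma \<open>\<tau>_d1\<close>), and it is 1
  on a multiple of the cocycle of this deformation (lemma \<open>witness\<close>). So everything comes down
  to the claim that a cocycle with \<open>\<tau> \<omega> = 0\<close> is a coboundary (theorem \<open>kernel_\<tau>\<close>).

  The claim is proved in three steps. First, \<open>T = D + R\<close> acts diagonalisably, so \<open>\<omega>\<close> can be
  replaced by a cohomologous \<open>T\<close>-invariant cocycle (theorem \<open>cohomologous_invariant\<close>). As the
  eigenvalues of \<open>D\<close> are integers and those of \<open>R\<close> are \<open>0, \<i>, - \<i>\<close>, invariance under \<open>T\<close> amounts
  to invariance under both, and \<open>\<omega>\<close> is now given by a few sequences of scalars. Second,
  subtracting the coboundary of a weight-preserving map achieves \<open>\<omega> (H, x) = 0\<close> for all \<open>x\<close> and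
  kills three more scalars (lemma \<open>invariant_cocycle_coboundary\<close>). Third, such a normalised
  cocycle is zero (lemma \<open>normalised_cocycle_vanishes\<close>): it is invariant under \<open>H\<close>, which forces
  it to vanish on \<open>sl\<^sub>2\<close> and so to be \<open>sl\<^sub>2\<close>-invariant. Its components at \<open>R\<close> and \<open>M\<close> on the pairs
  \<open>X\<^sup>s\<^sub>i, X\<^sup>-\<^sup>s\<^sub>j\<close> are invariant forms and vanish by the normalisation. What remains on these pairs
  is an invariant map to \<open>sl\<^sub>2\<close>, which is unique up to a scalar. The cocycle condition for
  \<open>X\<^sup>s\<^sub>0, X\<^sup>s\<^sub>3, X\<^sup>-\<^sup>s\<^bsub>n-2\<^esub>\<close> makes this scalar zero. Here \<open>n \<ge> 3\<close> enters: the index 3 has to exist.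
  Finally, the values on \<open>R\<close> and \<open>M\<close> are scalars that single cocycle conditions relate to \<open>\<tau> \<omega>\<close>
  and to the values that are already zero.
\<close>

section \<open>Cochains, cocycles and coboundaries of a Lie algebra\<close>

interpretation vec: vector_space vscale
  by unfold_locales (auto simp: vscale_def fun_eq_iff algebra_simps)

text \<open>
  Cochains are linear on \<open>V\<close> only, so each rule for them carries membership premises.
\<close>
lemma linear_on_props:
  assumes "linear_on V f" "vec.subspace V"
  shows linear_on_add: "x \<in> V \<Longrightarrow> y \<in> V \<Longrightarrow> f (x + y) = f x + f y"
    and linear_on_scale: "x \<in> V \<Longrightarrow> f (vscale c x) = vscale c (f x)"
    and linear_on_zero: "f 0 = 0"
    and linear_on_minus: "x \<in> V \<Longrightarrow> f (- x) = - f x"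
    and linear_on_diff: "x \<in> V \<Longrightarrow> y \<in> V \<Longrightarrow> f (x - y) = f x - f y"
proof -
  show add: "f (x + y) = f x + f y" if "x \<in> V" "y \<in> V" for x y
    using assms(1) that by (simp add: linear_on_def)
  show scale: "f (vscale c x) = vscale c (f x)" if "x \<in> V" for x c
    using assms(1) that by (simp add: linear_on_def)
  show "f 0 = 0"
    using scale[OF vec.subspace_0[OF assms(2)], of 0] by simp
  show minus: "f (- x) = - f x" if "x \<in> V" for x
    using scale[OF that, of "-1"] by simp
  show "f (x - y) = f x - f y" if "x \<in> V" "y \<in> V" for x y
    using add[OF that(1) vec.subspace_neg[OF assms(2) that(2)]] minus[OF that(2)] by simp
qed

lemma linear_on_sum:
  assumes "linear_on V f" "vec.subspace V" "\<And>i. i \<in> I \<Longrightarrow> g i \<in> V"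
  shows "f (\<Sum>i\<in>I. g i) = (\<Sum>i\<in>I. f (g i))"
  using assms(3)
proof (induction I rule: infinite_finite_induct)
  case (insert i I)
  have "f (g i + sum g I) = f (g i) + f (sum g I)"
    by (intro linear_on_add[OF assms(1,2)] vec.subspace_sum[OF assms(2)] insert.prems) simp_all
  then show ?case
    using insert by (simp only: sum.insert insert_iff simp_thms)
qed (simp_all add: linear_on_zero[OF assms(1,2)])

text \<open>
  The derived rules below are conditional rewrite rules. Together with \<open>V_closed\<close> they let the
  simplifier expand cochain identities once the vectors are known to lie in \<open>V\<close>. The Jacobi
  identity is stated as the derivation property of \<open>br x\<close>, which is the form used for
  invariance.
\<close>
locale lie_algebra_on =
  fixes V :: "('i \<Rightarrow> complex) set"
    and br :: "('i \<Rightarrow> complex) \<Rightarrow> ('i \<Rightarrow> complex) \<Rightarrow> ('i \<Rightarrow> complex)"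
  assumes subspace: "vec.subspace V"
    and br_closed: "x \<in> V \<Longrightarrow> y \<in> V \<Longrightarrow> br x y \<in> V"
    and br_linear: "x \<in> V \<Longrightarrow> linear_on V (br x)"
    and br_linear': "y \<in> V \<Longrightarrow> linear_on V (\<lambda>x. br x y)"
    and br_self: "x \<in> V \<Longrightarrow> br x x = 0"
    and jacobi: "x \<in> V \<Longrightarrow> y \<in> V \<Longrightarrow> z \<in> V \<Longrightarrow> br x (br y z) = br (br x y) z + br y (br x z)"
begin

lemma V_closed [simp]:
  "0 \<in> V" "x \<in> V \<Longrightarrow> y \<in> V \<Longrightarrow> x + y \<in> V" "x \<in> V \<Longrightarrow> y \<in> V \<Longrightarrow> x - y \<in> V"
  "x \<in> V \<Longrightarrow> - x \<in> V" "x \<in> V \<Longrightarrow> vscale c x \<in> V" "x \<in> V \<Longrightarrow> y \<in> V \<Longrightarrow> br x y \<in> V"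
  using subspace br_closed
  by (simp_all add: vec.subspace_0 vec.subspace_add vec.subspace_diff vec.subspace_neg
      vec.subspace_scale)

lemma br_simps:
  "x \<in> V \<Longrightarrow> y \<in> V \<Longrightarrow> z \<in> V \<Longrightarrow> br x (y + z) = br x y + br x z"
  "x \<in> V \<Longrightarrow> y \<in> V \<Longrightarrow> z \<in> V \<Longrightarrow> br x (y - z) = br x y - br x z"
  "x \<in> V \<Longrightarrow> y \<in> V \<Longrightarrow> br x (- y) = - br x y"
  "x \<in> V \<Longrightarrow> y \<in> V \<Longrightarrow> br x (vscale c y) = vscale c (br x y)"
  "x \<in> V \<Longrightarrow> br x 0 = 0"
  "x \<in> V \<Longrightarrow> y \<in> V \<Longrightarrow> z \<in> V \<Longrightarrow> br (x + y) z = br x z + br y z"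
  "x \<in> V \<Longrightarrow> y \<in> V \<Longrightarrow> z \<in> V \<Longrightarrow> br (x - y) z = br x z - br y z"
  "x \<in> V \<Longrightarrow> y \<in> V \<Longrightarrow> br (- x) y = - br x y"
  "x \<in> V \<Longrightarrow> y \<in> V \<Longrightarrow> br (vscale c x) y = vscale c (br x y)"
  "y \<in> V \<Longrightarrow> br 0 y = 0"
  by (simp_all add: linear_on_add[OF br_linear subspace] linear_on_diff[OF br_linear subspace]
      linear_on_minus[OF br_linear subspace] linear_on_scale[OF br_linear subspace]
      linear_on_zero[OF br_linear subspace]
      linear_on_add[OF br_linear' subspace] linear_on_diff[OF br_linear' subspace]
      linear_on_minus[OF br_linear' subspace] linear_on_scale[OF br_linear' subspace]
      linear_on_zero[OF br_linear' subspace])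

lemma br_swap:
  assumes "x \<in> V" "y \<in> V" shows "br x y = - br y x"
proof -
  have "br x y + br y x = br (x + y) (x + y)"
    using assms by (simp add: br_simps br_self[of x] br_self[of y])
  then show ?thesis
    using br_self[of "x + y"] assms by (simp add: eq_neg_iff_add_eq_0)
qed

lemma C1_linear: "f \<in> C1 V \<Longrightarrow> linear_on V f"
  by (simp add: C1_def)

lemma C1_simps:
  assumes "f \<in> C1 V"
  shows "x \<in> V \<Longrightarrow> f x \<in> V"
    "x \<in> V \<Longrightarrow> y \<in> V \<Longrightarrow> f (x + y) = f x + f y"
    "x \<in> V \<Longrightarrow> y \<in> V \<Longrightarrow> f (x - y) = f x - f y"
    "x \<in> V \<Longrightarrow> f (- x) = - f x"
    "x \<in> V \<Longrightarrow> f (vscale c x) = vscale c (f x)"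
    "f 0 = 0"
  using linear_on_props[OF C1_linear[OF assms] subspace] assms by (auto simp: C1_def)

lemma C2_linear: "\<omega> \<in> C2 V \<Longrightarrow> x \<in> V \<Longrightarrow> linear_on V (\<omega> x)"
  and C2_linear': "\<omega> \<in> C2 V \<Longrightarrow> y \<in> V \<Longrightarrow> linear_on V (\<lambda>x. \<omega> x y)"
  by (simp_all add: C2_def)

lemma C2_simps:
  assumes "\<omega> \<in> C2 V"
  shows "x \<in> V \<Longrightarrow> y \<in> V \<Longrightarrow> \<omega> x y \<in> V"
    "x \<in> V \<Longrightarrow> y \<in> V \<Longrightarrow> z \<in> V \<Longrightarrow> \<omega> x (y + z) = \<omega> x y + \<omega> x z"
    "x \<in> V \<Longrightarrow> y \<in> V \<Longrightarrow> z \<in> V \<Longrightarrow> \<omega> x (y - z) = \<omega> x y - \<omega> x z"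
    "x \<in> V \<Longrightarrow> y \<in> V \<Longrightarrow> \<omega> x (- y) = - \<omega> x y"
    "x \<in> V \<Longrightarrow> y \<in> V \<Longrightarrow> \<omega> x (vscale c y) = vscale c (\<omega> x y)"
    "x \<in> V \<Longrightarrow> \<omega> x 0 = 0"
    "x \<in> V \<Longrightarrow> y \<in> V \<Longrightarrow> z \<in> V \<Longrightarrow> \<omega> (x + y) z = \<omega> x z + \<omega> y z"
    "x \<in> V \<Longrightarrow> y \<in> V \<Longrightarrow> z \<in> V \<Longrightarrow> \<omega> (x - y) z = \<omega> x z - \<omega> y z"
    "x \<in> V \<Longrightarrow> y \<in> V \<Longrightarrow> \<omega> (- x) y = - \<omega> x y"
    "x \<in> V \<Longrightarrow> y \<in> V \<Longrightarrow> \<omega> (vscale c x) y = vscale c (\<omega> x y)"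
    "y \<in> V \<Longrightarrow> \<omega> 0 y = 0"
  using linear_on_props[OF C2_linear[OF assms] subspace]
    linear_on_props[OF C2_linear'[OF assms] subspace] assms
  by (auto simp: C2_def)

lemma C2_alt:
  assumes "\<omega> \<in> C2 V"
  shows C2_self: "x \<in> V \<Longrightarrow> \<omega> x x = 0"
    and C2_swap: "x \<in> V \<Longrightarrow> y \<in> V \<Longrightarrow> \<omega> x y = - \<omega> y x"
proof -
  show self: "\<omega> x x = 0" if "x \<in> V" for x
    using assms that by (simp add: C2_def)
  show "\<omega> x y = - \<omega> y x" if "x \<in> V" "y \<in> V" for x y
    using self[of "x + y"] that self[of x] self[of y]
    by (simp add: C2_simps[OF assms] eq_neg_iff_add_eq_0 add.commute)
qed

lemma Z2_D:
  assumes "\<omega> \<in> Z2 V br"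
  shows Z2_C2: "\<omega> \<in> C2 V"
    and Z2_cocycle: "x \<in> V \<Longrightarrow> y \<in> V \<Longrightarrow> z \<in> V \<Longrightarrow>
      br x (\<omega> y z) - br y (\<omega> x z) + br z (\<omega> x y)
       - \<omega> (br x y) z + \<omega> (br x z) y - \<omega> (br y z) x = 0"
proof -
  show "\<omega> \<in> C2 V" using assms by (simp add: Z2_def)
  have "d2 V br \<omega> x y z = 0" for x y z
    using assms by (simp add: Z2_def)
  then show "br x (\<omega> y z) - br y (\<omega> x z) + br z (\<omega> x y)
       - \<omega> (br x y) z + \<omega> (br x z) y - \<omega> (br y z) x = 0" if "x \<in> V" "y \<in> V" "z \<in> V"
    using that unfolding d2_def by (metis (no_types, lifting))
qed

lemma Z2_I:
  assumes "\<omega> \<in> C2 V"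
    and "\<And>x y z. x \<in> V \<Longrightarrow> y \<in> V \<Longrightarrow> z \<in> V \<Longrightarrow>
      br x (\<omega> y z) - br y (\<omega> x z) + br z (\<omega> x y)
       - \<omega> (br x y) z + \<omega> (br x z) y - \<omega> (br y z) x = 0"
  shows "\<omega> \<in> Z2 V br"
  using assms unfolding Z2_def d2_def by (auto simp: fun_eq_iff)

lemma C2_ext:
  assumes "\<omega> \<in> C2 V" "\<eta> \<in> C2 V" "\<And>x y. x \<in> V \<Longrightarrow> y \<in> V \<Longrightarrow> \<omega> x y = \<eta> x y"
  shows "\<omega> = \<eta>"
proof (intro ext)
  fix x y i
  show "\<omega> x y i = \<eta> x y i"
    using assms by (cases "x \<in> V \<and> y \<in> V") (auto simp: C2_def)
qed

lemma d1_C2: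
  assumes f: "f \<in> C1 V"
  shows "d1 V br f \<in> C2 V"
  unfolding C2_def linear_on_def d1_def
  by (auto simp: br_simps C1_simps[OF f] br_self vec.scale_right_diff_distrib)

text \<open>
  In \<open>d2 (d1 f)\<close> the terms \<open>br x (br y (f z))\<close> cancel by the Jacobi identity in the module, and
  the terms \<open>f (br x (br y z))\<close> by the Jacobi identity inside \<open>f\<close>.
\<close>
lemma d1_Z2:
  assumes f: "f \<in> C1 V"
  shows "d1 V br f \<in> Z2 V br"
proof (rule Z2_I[OF d1_C2[OF f]])
  fix x y z assume V: "x \<in> V" "y \<in> V" "z \<in> V"
  note S = br_simps C1_simps[OF f]
  have 1: "br x (br y (f z)) = br (br x y) (f z) + br y (br x (f z))"
    by (intro jacobi V C1_simps(1)[OF f])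
  have 2: "br x (br z (f y)) = br (br x z) (f y) + br z (br x (f y))"
    by (intro jacobi V C1_simps(1)[OF f])
  have 3: "br y (br z (f x)) = br (br y z) (f x) + br z (br y (f x))"
    by (intro jacobi V C1_simps(1)[OF f])
  have 4: "f (br x (br y z)) = f (br (br x y) z) + f (br y (br x z))"
    using V by (subst jacobi[OF V]) (simp add: S)
  have 5: "br (br x z) y = - br y (br x z)" "br (br y z) x = - br x (br y z)"
    using V by (auto intro: br_swap)
  show "br x (d1 V br f y z) - br y (d1 V br f x z) + br z (d1 V br f x y)
    - d1 V br f (br x y) z + d1 V br f (br x z) y - d1 V br f (br y z) x = 0"
    using V by (simp add: d1_def S 1 2 3 4 5 algebra_simps)
qed

lemma C1_add: "f \<in> C1 V \<Longrightarrow> g \<in> C1 V \<Longrightarrow> f + g \<in> C1 V"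
  and C1_scale: "f \<in> C1 V \<Longrightarrow> (\<lambda>x. vscale c (f x)) \<in> C1 V"
  by (auto simp: C1_def linear_on_def vec.scale_right_distrib mult.commute)

lemma d1_add:
  assumes "f \<in> C1 V" "g \<in> C1 V" shows "d1 V br (f + g) = d1 V br f + d1 V br g"
  by (auto simp: d1_def fun_eq_iff br_simps C1_simps(1)[OF assms(1)] C1_simps(1)[OF assms(2)])

lemma d1_scale:
  assumes "f \<in> C1 V" shows "d1 V br (\<lambda>x. vscale c (f x)) = (\<lambda>x y. vscale c (d1 V br f x y))"
  by (auto simp: d1_def fun_eq_iff br_simps C1_simps(1)[OF assms] vec.scale_right_diff_distrib)

lemma C2_add:
  assumes "\<omega> \<in> C2 V" "\<eta> \<in> C2 V" shows "\<omega> + \<eta> \<in> C2 V"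
  using assms unfolding C2_def linear_on_def by (auto simp: vec.scale_right_distrib)

lemma C2_scale:
  assumes "\<omega> \<in> C2 V" shows "(\<lambda>x y. vscale c (\<omega> x y)) \<in> C2 V"
  using assms unfolding C2_def linear_on_def by (auto simp: vec.scale_right_distrib mult.commute)

lemma Z2_add:
  assumes "\<omega> \<in> Z2 V br" "\<eta> \<in> Z2 V br" shows "\<omega> + \<eta> \<in> Z2 V br"
proof (rule Z2_I[OF C2_add[OF Z2_C2[OF assms(1)] Z2_C2[OF assms(2)]]])
  fix x y z assume V: "x \<in> V" "y \<in> V" "z \<in> V"
  show "br x ((\<omega> + \<eta>) y z) - br y ((\<omega> + \<eta>) x z) + br z ((\<omega> + \<eta>) x y)
       - (\<omega> + \<eta>) (br x y) z + (\<omega> + \<eta>) (br x z) y - (\<omega> + \<eta>) (br y z) x = 0"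
    using arg_cong2[OF Z2_cocycle[OF assms(1) V] Z2_cocycle[OF assms(2) V], of "(+)"] V
    by (simp add: br_simps C2_simps(1)[OF Z2_C2[OF assms(1)]] C2_simps(1)[OF Z2_C2[OF assms(2)]]
        algebra_simps)
qed

lemma Z2_scale:
  assumes "\<omega> \<in> Z2 V br" shows "(\<lambda>x y. vscale c (\<omega> x y)) \<in> Z2 V br"
proof (rule Z2_I[OF C2_scale[OF Z2_C2[OF assms(1)]]])
  fix x y z assume V: "x \<in> V" "y \<in> V" "z \<in> V"
  have "br x (vscale c (\<omega> y z)) - br y (vscale c (\<omega> x z)) + br z (vscale c (\<omega> x y))
       - vscale c (\<omega> (br x y) z) + vscale c (\<omega> (br x z) y) - vscale c (\<omega> (br y z) x)
    = vscale c (br x (\<omega> y z) - br y (\<omega> x z) + br z (\<omega> x y)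
       - \<omega> (br x y) z + \<omega> (br x z) y - \<omega> (br y z) x)"
    using V by (simp only: br_simps C2_simps(1)[OF Z2_C2[OF assms(1)]]
        vec.scale_right_distrib vec.scale_right_diff_distrib)
  then show "br x (vscale c (\<omega> y z)) - br y (vscale c (\<omega> x z)) + br z (vscale c (\<omega> x y))
       - vscale c (\<omega> (br x y) z) + vscale c (\<omega> (br x z) y) - vscale c (\<omega> (br y z) x) = 0"
    by (simp only: Z2_cocycle[OF assms(1) V] vec.scale_zero_right)
qed

lemma Z2_diff:
  assumes "\<omega> \<in> Z2 V br" "\<eta> \<in> Z2 V br" shows "\<omega> - \<eta> \<in> Z2 V br"
proof -
  have "\<omega> - \<eta> = \<omega> + (\<lambda>x y. vscale (-1) (\<eta> x y))"
    by (simp add: fun_eq_iff)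
  then show ?thesis
    using Z2_add[OF assms(1) Z2_scale[OF assms(2), of "-1"]] by (simp only:)
qed

lemma B2_Z2: "B2 V br \<subseteq> Z2 V br"
  using d1_Z2 by (auto simp: B2_def)

lemma B2_add: "\<omega> \<in> B2 V br \<Longrightarrow> \<eta> \<in> B2 V br \<Longrightarrow> \<omega> + \<eta> \<in> B2 V br"
  unfolding B2_def by (elim imageE) (auto simp: d1_add[symmetric] C1_add)

lemma B2_scale: "\<omega> \<in> B2 V br \<Longrightarrow> (\<lambda>x y. vscale c (\<omega> x y)) \<in> B2 V br"
  unfolding B2_def by (elim imageE) (auto simp: d1_scale[symmetric] C1_scale)

text \<open>
  A linear functional on cocycles whose kernel is the space of coboundaries takes a single value
  on each coset, and so induces an injective map on the quotient. One cocycle with value 1 makes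
  the map surjective.
\<close>
theorem H2_one_dimensional:
  fixes \<tau> :: "(('i \<Rightarrow> complex) \<Rightarrow> ('i \<Rightarrow> complex) \<Rightarrow> ('i \<Rightarrow> complex)) \<Rightarrow> complex"
  assumes add: "\<And>\<omega> \<eta>. \<omega> \<in> Z2 V br \<Longrightarrow> \<eta> \<in> Z2 V br \<Longrightarrow> \<tau> (\<omega> + \<eta>) = \<tau> \<omega> + \<tau> \<eta>"
    and scale: "\<And>c \<omega>. \<omega> \<in> Z2 V br \<Longrightarrow> \<tau> (\<lambda>x y. vscale c (\<omega> x y)) = c * \<tau> \<omega>"
    and kernel: "\<And>\<omega>. \<omega> \<in> Z2 V br \<Longrightarrow> \<tau> \<omega> = 0 \<longleftrightarrow> \<omega> \<in> B2 V br"
    and witness: "\<omega>0 \<in> Z2 V br" "\<tau> \<omega>0 = 1"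
  shows "linear_isomorphic (H2 V br) (H2_scale V br) (UNIV :: complex set) (*)"
proof -
  let ?B = "B2 V br" and ?Z = "Z2 V br"
  define sc where "sc c \<omega> = (\<lambda>x y. vscale c (\<omega> x y))"
    for c and \<omega> :: "('i \<Rightarrow> complex) \<Rightarrow> ('i \<Rightarrow> complex) \<Rightarrow> ('i \<Rightarrow> complex)"
  have scZ: "sc c \<omega> \<in> ?Z" if "\<omega> \<in> ?Z" for c \<omega>
    using Z2_scale[OF that] by (simp add: sc_def)
  have sct: "\<tau> (sc c \<omega>) = c * \<tau> \<omega>" if "\<omega> \<in> ?Z" for c \<omega>
    using scale[OF that] by (simp add: sc_def)
  have scB: "sc c \<omega> \<in> ?B" if "\<omega> \<in> ?B" for c \<omega>
    using B2_scale[OF that] by (simp add: sc_def)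
  have neg: "sc (-1) \<omega> = - \<omega>" for \<omega>
    by (simp add: sc_def fun_eq_iff)
  have zeroB: "0 \<in> ?B"
    using scB[of _ 0] kernel[OF scZ[OF witness(1), of 0]] sct[OF witness(1), of 0]
    by (simp add: sc_def zero_fun_def)
  have const: "\<tau> \<eta> = \<tau> \<omega>" if \<omega>: "\<omega> \<in> ?Z" and \<eta>: "\<eta> \<in> \<omega> +o ?B" for \<omega> \<eta>
  proof -
    obtain b where "b \<in> ?B" "\<eta> = \<omega> + b" using \<eta> by (auto simp: elt_set_plus_def)
    then show ?thesis using add[OF \<omega>, of b] B2_Z2 kernel[of b] by auto
  qed
  define \<phi> where "\<phi> X = (THE t. \<forall>\<eta>\<in>X. \<tau> \<eta> = t)" for X
  have phi: "\<phi> (\<omega> +o ?B) = \<tau> \<omega>" if "\<omega> \<in> ?Z" for \<omega>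
    unfolding \<phi>_def
  proof (rule the_equality)
    show "\<forall>\<eta>\<in>\<omega> +o ?B. \<tau> \<eta> = \<tau> \<omega>" using const[OF that] by blast
    have "\<omega> \<in> \<omega> +o ?B" using zeroB by (force simp: elt_set_plus_def)
    then show "t = \<tau> \<omega>" if "\<forall>\<eta>\<in>\<omega> +o ?B. \<tau> \<eta> = t" for t using that by auto
  qed
  have BB: "?B + ?B = ?B"
    using B2_add zeroB by (auto simp: set_plus_def) (metis add_0)
  have coset_add: "(\<omega> +o ?B) + (\<eta> +o ?B) = (\<omega> + \<eta>) +o ?B" for \<omega> \<eta>
    by (simp add: set_plus_rearrange BB)
  have coset_scale: "H2_scale V br c (\<omega> +o ?B) = sc c \<omega> +o ?B" for c \<omega>
  proof
    have sc_add: "sc c (\<omega> + b) = sc c \<omega> + sc c b" for b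
      by (simp add: sc_def fun_eq_iff vec.scale_right_distrib)
    show "H2_scale V br c (\<omega> +o ?B) \<subseteq> sc c \<omega> +o ?B"
    proof
      fix \<eta> assume "\<eta> \<in> H2_scale V br c (\<omega> +o ?B)"
      then obtain b b' where "b \<in> ?B" "b' \<in> ?B" "\<eta> = sc c (\<omega> + b) + b'"
        by (auto simp: H2_scale_def set_plus_def elt_set_plus_def sc_def)
      then have "\<eta> = sc c \<omega> + (sc c b + b')" "sc c b + b' \<in> ?B"
        using sc_add scB B2_add by (auto simp: add.assoc)
      then show "\<eta> \<in> sc c \<omega> +o ?B" by (auto simp: elt_set_plus_def)
    qed
    show "sc c \<omega> +o ?B \<subseteq> H2_scale V br c (\<omega> +o ?B)"
    proof
      fix \<eta> assume "\<eta> \<in> sc c \<omega> +o ?B"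
      then obtain b where b: "b \<in> ?B" "\<eta> = sc c \<omega> + b" by (auto simp: elt_set_plus_def)
      have "\<omega> \<in> \<omega> +o ?B" using zeroB by (force simp: elt_set_plus_def)
      then show "\<eta> \<in> H2_scale V br c (\<omega> +o ?B)"
        unfolding H2_scale_def b(2) by (intro set_plus_intro b(1)) (auto simp: sc_def)
    qed
  qed
  have "inj_on \<phi> (H2 V br)"
  proof (rule inj_onI)
    fix X Y assume "X \<in> H2 V br" "Y \<in> H2 V br" "\<phi> X = \<phi> Y"
    then obtain \<omega> \<eta> where *: "\<omega> \<in> ?Z" "\<eta> \<in> ?Z" "X = \<omega> +o ?B" "Y = \<eta> +o ?B" "\<tau> \<omega> = \<tau> \<eta>"
      using phi by (auto simp: H2_def)
    have "\<tau> (\<omega> + sc (-1) \<eta>) = 0"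
      using * by (simp only: add scZ sct) simp
    then have "\<omega> - \<eta> \<in> ?B"
      using kernel[OF Z2_add[OF *(1) scZ[OF *(2), of "-1"]]] by (simp only: neg add_uminus_conv_diff simp_thms)
    have "(\<omega> - \<eta>) +o ?B = ?B"
    proof
      show "(\<omega> - \<eta>) +o ?B \<subseteq> ?B"
        using B2_add[OF \<open>\<omega> - \<eta> \<in> ?B\<close>] by (auto simp: elt_set_plus_def)
      show "?B \<subseteq> (\<omega> - \<eta>) +o ?B"
      proof
        fix b assume "b \<in> ?B"
        then have "- (\<omega> - \<eta>) + b \<in> ?B"
          using B2_add scB[OF \<open>\<omega> - \<eta> \<in> ?B\<close>, of "-1"] neg by metis
        moreover have "b = (\<omega> - \<eta>) + (- (\<omega> - \<eta>) + b)" by (simp only: add_minus_cancel)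
        ultimately show "b \<in> (\<omega> - \<eta>) +o ?B" unfolding elt_set_plus_def by blast
      qed
    qed
    then have "\<eta> +o ((\<omega> - \<eta>) +o ?B) = \<eta> +o ?B" by simp
    then show "X = Y" unfolding * by (simp add: set_plus_rearrange2)
  qed
  moreover have "\<phi> ` H2 V br = UNIV"
  proof -
    have "c \<in> \<phi> ` H2 V br" for c
      using phi[OF scZ[OF witness(1), of c]] sct[OF witness(1), of c] witness(2) scZ[OF witness(1), of c]
      unfolding H2_def by (metis (no_types, lifting) image_eqI mult.right_neutral)
    then show ?thesis by blast
  qed
  moreover have "\<phi> (X + Y) = \<phi> X + \<phi> Y" if "X \<in> H2 V br" "Y \<in> H2 V br" for X Y
    using that phi add Z2_add by (auto simp: H2_def coset_add)
  moreover have "\<phi> (H2_scale V br c X) = c * \<phi> X" if "X \<in> H2 V br" for X c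
    using that phi scZ sct by (auto simp: H2_def coset_scale)
  ultimately show ?thesis
    unfolding linear_isomorphic_def bij_betw_def by blast
qed

section \<open>Cocycles invariant under an element\<close>

text \<open>
  This says that the Lie derivative of \<open>\<omega>\<close> along \<open>T\<close> is zero on \<open>V\<close>.
\<close>
definition invariant where
  "invariant T \<omega> \<longleftrightarrow> (\<forall>x\<in>V. \<forall>y\<in>V. br T (\<omega> x y) = \<omega> (br T x) y + \<omega> x (br T y))"

text \<open>
  Cartan's formula for a cocycle: the Lie derivative along \<open>t\<close> is the coboundary of the
  contraction \<open>\<omega> t\<close>.
\<close>
lemma cocycle_lie_derivative:
  assumes "\<omega> \<in> Z2 V br" "t \<in> V" "x \<in> V" "y \<in> V"
  shows "br t (\<omega> x y) - \<omega> (br t x) y - \<omega> x (br t y)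
    = br x (\<omega> t y) - br y (\<omega> t x) - \<omega> t (br x y)"
  using Z2_cocycle[OF assms] C2_swap[OF Z2_C2[OF assms(1)], of x "br t y"]
    C2_swap[OF Z2_C2[OF assms(1)], of t "br x y"] assms
  by (simp add: algebra_simps)

lemma cocycle_invariantI:
  assumes "\<omega> \<in> Z2 V br" "t \<in> V" "\<And>x. x \<in> V \<Longrightarrow> \<omega> t x = 0"
  shows "invariant t \<omega>"
  unfolding invariant_def
proof (intro ballI)
  fix x y assume "x \<in> V" "y \<in> V"
  then show "br t (\<omega> x y) = \<omega> (br t x) y + \<omega> x (br t y)"
    using cocycle_lie_derivative[OF assms(1,2), of x y] assms(3)
    by (simp add: br_simps algebra_simps)
qed

lemma invariant_d1:
  assumes f: "f \<in> C1 V" and t: "t \<in> V" and comm: "\<And>x. x \<in> V \<Longrightarrow> f (br t x) = br t (f x)"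
  shows "invariant t (d1 V br f)"
  unfolding invariant_def
proof (intro ballI)
  fix x y assume V: "x \<in> V" "y \<in> V"
  have "br t (br x (f y)) = br (br t x) (f y) + br x (br t (f y))"
    "br t (br y (f x)) = br (br t y) (f x) + br y (br t (f x))"
    "br t (br x y) = br (br t x) y + br x (br t y)"
    using V t C1_simps(1)[OF f] by (intro jacobi; simp)+
  moreover have "br t (f (br x y)) = f (br t (br x y))"
    using V by (intro comm[symmetric]) simp
  ultimately show "br t (d1 V br f x y) = d1 V br f (br t x) y + d1 V br f x (br t y)"
    using V t by (simp add: d1_def br_simps C1_simps[OF f] comm algebra_simps)
qed

lemma invariant_diff:
  assumes "invariant t \<omega>" "invariant t \<eta>" "t \<in> V" "\<omega> \<in> C2 V" "\<eta> \<in> C2 V"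
  shows "invariant t (\<omega> - \<eta>)"
  using assms by (simp add: invariant_def br_simps C2_simps(1) algebra_simps)

text \<open>
  The exterior product of a one-cocycle \<open>\<xi>\<close> with trivial coefficients and a derivation \<open>\<delta>\<close>,
  which is a one-cocycle with adjoint coefficients, is a cocycle. The factor of each \<open>\<xi>\<close> in the
  cocycle condition is the derivation property of \<open>\<delta>\<close> for the other two arguments.
\<close>
lemma functional_wedge_derivation:
  assumes \<delta>: "\<delta> \<in> C1 V" "d1 V br \<delta> = 0"
    and add: "\<And>x y. x \<in> V \<Longrightarrow> y \<in> V \<Longrightarrow> \<xi> (x + y) = \<xi> x + (\<xi> y :: complex)"
    and scale: "\<And>c x. x \<in> V \<Longrightarrow> \<xi> (vscale c x) = c * \<xi> x"
    and closed: "\<And>x y. x \<in> V \<Longrightarrow> y \<in> V \<Longrightarrow> \<xi> (br x y) = 0"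
  shows "(\<lambda>x y. if x \<in> V \<and> y \<in> V then vscale (\<xi> x) (\<delta> y) - vscale (\<xi> y) (\<delta> x) else 0) \<in> Z2 V br"
    (is "?\<omega> \<in> _")
proof (rule Z2_I)
  note S = C1_simps[OF \<delta>(1)]
  show "?\<omega> \<in> C2 V"
    unfolding C2_def linear_on_def
    by (auto simp: S add scale vec.scale_left_distrib vec.scale_right_diff_distrib
        vec.scale_right_distrib mult_ac)
  have der: "\<delta> (br x y) = br x (\<delta> y) - br y (\<delta> x)" if "x \<in> V" "y \<in> V" for x y
  proof -
    have "d1 V br \<delta> x y = 0" using \<delta>(2) by simp
    then show ?thesis using that by (simp add: d1_def)
  qed
  fix x y z assume V: "x \<in> V" "y \<in> V" "z \<in> V"
  show "br x (?\<omega> y z) - br y (?\<omega> x z) + br z (?\<omega> x y)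
       - ?\<omega> (br x y) z + ?\<omega> (br x z) y - ?\<omega> (br y z) x = 0"
    using V by (simp add: closed br_simps S der vec.scale_right_diff_distrib algebra_simps)
qed

end

section \<open>Reduction to cocycles invariant under a diagonalisable element\<close>

text \<open>
  \<open>E\<close> is a basis of eigenvectors of \<open>T\<close> with weights \<open>wt\<close>, and \<open>co\<close> are its coordinates. These
  are taken to be linear on the whole function type, which saves membership premises.
\<close>
locale eigenbasis = lie_algebra_on V br
  for V :: "('i \<Rightarrow> complex) set" and br +
  fixes T :: "'i \<Rightarrow> complex" and I :: "'k set" and E :: "'k \<Rightarrow> 'i \<Rightarrow> complex"
    and co :: "'k \<Rightarrow> ('i \<Rightarrow> complex) \<Rightarrow> complex" and wt :: "'k \<Rightarrow> complex"
  assumes T_in: "T \<in> V"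
    and finite_I: "finite I"
    and E_in: "i \<in> I \<Longrightarrow> E i \<in> V"
    and co_add: "co i (x + y) = co i x + co i y"
    and co_scale: "co i (vscale c x) = c * co i x"
    and co_E: "i \<in> I \<Longrightarrow> j \<in> I \<Longrightarrow> co i (E j) = (if i = j then 1 else 0)"
    and expand: "x \<in> V \<Longrightarrow> x = (\<Sum>i\<in>I. vscale (co i x) (E i))"
    and eigen: "i \<in> I \<Longrightarrow> br T (E i) = vscale (wt i) (E i)"
begin

lemma co_zero: "co i 0 = 0"
  using co_scale[of i 0 0] by simp

lemma co_minus: "co i (- x) = - co i x"
  using co_scale[of i "-1" x] by simp

lemma co_diff: "co i (x - y) = co i x - co i y"
  using co_add[of i x "- y"] co_minus[of i y] by simp

lemma co_sum: "co i (\<Sum>j\<in>J. g j) = (\<Sum>j\<in>J. co i (g j))"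
  by (rule additive.sum[of "co i"]) (simp add: additive.intro co_add)

lemma co_comb:
  assumes "i \<in> I" shows "co i (\<Sum>j\<in>I. vscale (a j) (E j)) = a i"
proof -
  have "co i (\<Sum>j\<in>I. vscale (a j) (E j)) = (\<Sum>j\<in>I. if j = i then a j else 0)"
    unfolding co_sum by (intro sum.cong refl) (simp add: co_scale co_E assms)
  then show ?thesis using assms finite_I by simp
qed

lemma co_ext:
  assumes "x \<in> V" "y \<in> V" "\<And>i. i \<in> I \<Longrightarrow> co i x = co i y" shows "x = y"
proof -
  have "x = (\<Sum>i\<in>I. vscale (co i y) (E i))"
    using assms(3) by (subst expand[OF assms(1)]) (auto intro!: sum.cong)
  then show ?thesis using expand[OF assms(2)] by simp
qed

lemma linear_on_vanish:
  assumes f: "linear_on V f" and 0: "\<And>i. i \<in> I \<Longrightarrow> f (E i) = 0" and x: "x \<in> V"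
  shows "f x = 0"
proof -
  have "f x = (\<Sum>i\<in>I. f (vscale (co i x) (E i)))"
    using linear_on_sum[OF f subspace, of I "\<lambda>i. vscale (co i x) (E i)"] expand[OF x] E_in
    by simp
  also have "\<dots> = (\<Sum>i\<in>I. 0)"
    by (intro sum.cong refl) (simp add: linear_on_scale[OF f subspace] E_in 0)
  finally show ?thesis by simp
qed

lemma C2_vanish:
  assumes \<omega>: "\<omega> \<in> C2 V" and 0: "\<And>i j. i \<in> I \<Longrightarrow> j \<in> I \<Longrightarrow> \<omega> (E i) (E j) = 0"
    and "x \<in> V" "y \<in> V"
  shows "\<omega> x y = 0"
proof -
  have *: "\<omega> (E i) y = 0" if "i \<in> I" for i
    using linear_on_vanish[of "\<omega> (E i)"] \<omega> 0 E_in that assms(4) by (simp add: C2_def)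
  show ?thesis
    using linear_on_vanish[of "\<lambda>x. \<omega> x y"] \<omega> * assms(3,4) by (simp add: C2_def)
qed

lemma co_br_T:
  assumes "i \<in> I" "x \<in> V" shows "co i (br T x) = wt i * co i x"
proof -
  have "br T x = (\<Sum>j\<in>I. br T (vscale (co j x) (E j)))"
    using linear_on_sum[OF br_linear[OF T_in] subspace, of I "\<lambda>i. vscale (co i x) (E i)"]
      expand[OF assms(2)] E_in by simp
  also have "\<dots> = (\<Sum>j\<in>I. vscale (co j x * wt j) (E j))"
    by (intro sum.cong refl) (simp add: br_simps T_in E_in eigen)
  finally show ?thesis using co_comb[OF assms(1)] by simp
qed

lemma linear_extension:
  assumes F: "\<And>i. i \<in> I \<Longrightarrow> F i \<in> V"
  obtains f where "f \<in> C1 V" "\<And>i. i \<in> I \<Longrightarrow> f (E i) = F i"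
proof
  define f where "f x = (if x \<in> V then (\<Sum>i\<in>I. vscale (co i x) (F i)) else 0)" for x
  show "f \<in> C1 V"
    unfolding C1_def linear_on_def f_def using subspace F
    by (auto intro!: vec.subspace_sum vec.subspace_scale
        simp: co_add co_scale vec.scale_left_distrib sum.distrib vec.scale_sum_right)
  show "f (E i) = F i" if "i \<in> I" for i
  proof -
    have "f (E i) = (\<Sum>j\<in>I. vscale (if j = i then 1 else 0) (F j))"
      using that E_in by (simp add: f_def co_E cong: sum.cong)
    also have "\<dots> = (\<Sum>j\<in>I. if j = i then F j else 0)"
      by (intro sum.cong refl) simp
    finally show ?thesis using that finite_I by simp
  qed
qed

lemma eigenvector_co:
  assumes "x \<in> V" "br T x = vscale c x" "i \<in> I" "wt i \<noteq> c"
  shows "co i x = 0"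
  using co_br_T[OF assms(3,1)] assms by (simp add: co_scale)

text \<open>
  Only the basis vectors of weight \<open>c\<close> contribute to an eigenvector of weight \<open>c\<close>.
\<close>
lemma eigenvector_expand:
  assumes "x \<in> V" "br T x = vscale c x" "J \<subseteq> I" "\<And>i. i \<in> I \<Longrightarrow> wt i = c \<Longrightarrow> i \<in> J"
  shows "x = (\<Sum>i\<in>J. vscale (co i x) (E i))"
proof -
  have "(\<Sum>i\<in>I. vscale (co i x) (E i)) = (\<Sum>i\<in>J. vscale (co i x) (E i))"
    using eigenvector_co[OF assms(1,2)] assms(3,4) finite_I
    by (intro sum.mono_neutral_right) auto
  then show ?thesis using expand[OF assms(1)] by simp
qed

text \<open>
  The Lie derivative \<open>L\<close> along \<open>T\<close> acts diagonalisably on cochains. Split the contraction \<open>\<omega> T\<close>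
  into its part \<open>h\<close> of weight zero and an image \<open>L f\<close>. Up to an inner derivation, the
  contraction of \<open>\<eta> = \<omega> - d1 f\<close> is then \<open>h\<close>, so \<open>L \<eta> = d1 h\<close> by Cartan's formula. The right side
  has weight zero, the left side lies in the image of \<open>L\<close>, and these two spaces meet in zero
  only.
\<close>
theorem cohomologous_invariant:
  assumes \<omega>: "\<omega> \<in> Z2 V br"
  obtains f where "f \<in> C1 V" "invariant T (\<omega> - d1 V br f)"
proof -
  note \<omega>2 = Z2_C2[OF \<omega>]
  \<comment> \<open>\<open>F\<close> inverts the Lie derivative on the components of nonzero weight of \<open>\<omega> T\<close>.\<close>
  define F where "F a = (\<Sum>g\<in>I. vscale (if wt g = wt a then 0
      else co g (\<omega> T (E a)) / (wt g - wt a)) (E g))" for a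
  have "F a \<in> V" for a
    unfolding F_def by (intro vec.subspace_sum subspace vec.subspace_scale E_in)
  then obtain f where f: "f \<in> C1 V" and fE: "\<And>i. i \<in> I \<Longrightarrow> f (E i) = F i"
    using linear_extension[of F] by blast
  note S = br_simps C1_simps[OF f] C2_simps[OF \<omega>2]
  define h where "h x = \<omega> T x - (br T (f x) - f (br T x))" for x
  have hV: "h x \<in> V" if "x \<in> V" for x
    using that T_in by (simp add: h_def S)
  have h_lin: "linear_on V h"
    using T_in by (auto simp: linear_on_def h_def S vec.scale_right_diff_distrib)
  note h_simps = linear_on_props[OF h_lin subspace]
  have h_eigen: "br T (h (E a)) = vscale (wt a) (h (E a))" if a: "a \<in> I" for a
  proof (rule co_ext)
    fix g assume g: "g \<in> I"
    have "co g (h (E a)) = co g (\<omega> T (E a)) - (wt g - wt a) * co g (F a)"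
      using a g E_in[OF a] T_in \<open>F a \<in> V\<close>
      by (simp add: h_def co_diff co_add co_br_T eigen S fE co_scale algebra_simps)
    then have "wt g \<noteq> wt a \<Longrightarrow> co g (h (E a)) = 0"
      using co_comb[OF g] by (simp add: F_def)
    then show "co g (br T (h (E a))) = co g (vscale (wt a) (h (E a)))"
      using co_br_T[OF g hV[OF E_in[OF a]]] by (auto simp: co_scale)
  qed (use a hV E_in T_in in auto)
  define \<eta> where "\<eta> = \<omega> - d1 V br f"
  have \<eta>: "\<eta> \<in> Z2 V br"
    unfolding \<eta>_def by (intro Z2_diff \<omega> d1_Z2 f)
  note \<eta>S = C2_simps[OF Z2_C2[OF \<eta>]]
  \<comment> \<open>\<open>K\<close> is the coboundary of \<open>h\<close>, written out since \<open>h\<close> need not vanish outside \<open>V\<close>.\<close>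
  define K where "K x y = br x (h y) - br y (h x) - h (br x y)" for x y
  have LK: "br T (\<eta> x y) - \<eta> (br T x) y - \<eta> x (br T y) = K x y" if "x \<in> V" "y \<in> V" for x y
  proof -
    have iT: "\<eta> T y = h y + br y (f T)" if "y \<in> V" for y
      using that T_in by (simp add: \<eta>_def d1_def h_def)
    \<comment> \<open>The contraction of \<open>\<eta>\<close> differs from \<open>h\<close> by the inner derivation of \<open>f T\<close>, which drops out.\<close>
    have "br x (br y (f T)) = br (br x y) (f T) + br y (br x (f T))"
      using that T_in by (intro jacobi) (auto simp: S)
    then show ?thesis
      unfolding cocycle_lie_derivative[OF \<eta> T_in that] K_def using that T_in
      by (simp add: iT S hV)
  qed
  have K0: "K (E a) (E b) = 0" if ab: "a \<in> I" "b \<in> I" for a b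
  proof -
    let ?x = "E a" and ?y = "E b" and ?c = "wt a + wt b"
    have V: "?x \<in> V" "?y \<in> V" "h ?x \<in> V" "h ?y \<in> V" using ab E_in hV by auto
    have "linear_on V (\<lambda>x. h (br T x) - br T (h x))"
      using T_in by (auto simp: linear_on_def h_simps S hV vec.scale_right_diff_distrib)
    then have comm: "h (br T x) = br T (h x)" if "x \<in> V" for x
      using linear_on_vanish[of "\<lambda>x. h (br T x) - br T (h x)"] h_eigen eigen that E_in
      by (simp add: h_simps)
    have 1: "br T (br ?x (h ?y)) = vscale ?c (br ?x (h ?y))"
      using V T_in ab by (subst jacobi) (simp_all add: eigen h_eigen S vec.scale_left_distrib)
    have 2: "br T (br ?y (h ?x)) = vscale ?c (br ?y (h ?x))"
      using V T_in ab by (subst jacobi) (simp_all add: eigen h_eigen S vec.scale_left_distrib)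
    have "br T (br ?x ?y) = vscale ?c (br ?x ?y)"
      using V T_in ab by (subst jacobi) (simp_all add: eigen S vec.scale_left_distrib)
    then have 3: "br T (h (br ?x ?y)) = vscale ?c (h (br ?x ?y))"
      using comm[of "br ?x ?y"] V by (simp add: h_simps)
    have KV: "K ?x ?y \<in> V" using V hV by (simp add: K_def)
    have eig: "br T (K ?x ?y) = vscale ?c (K ?x ?y)"
      using V T_in hV by (simp add: K_def S 1 2 3 vec.scale_right_diff_distrib)
    have K_eq: "K ?x ?y = br T (\<eta> ?x ?y) - vscale ?c (\<eta> ?x ?y)"
      using V ab T_in by (simp add: LK[symmetric] eigen \<eta>S vec.scale_left_distrib algebra_simps)
    show ?thesis
    proof (rule co_ext[OF KV])
      fix g assume g: "g \<in> I"
      show "co g (K ?x ?y) = co g 0"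
      \<comment> \<open>Weight \<open>?c\<close> is killed by the form \<open>K_eq\<close>, all other weights by \<open>eig\<close>.\<close>
      proof (cases "wt g = ?c")
        case True
        then show ?thesis
          using V g by (simp add: K_eq co_diff co_br_T co_scale \<eta>S co_zero)
      next
        case False
        then show ?thesis using eigenvector_co[OF KV eig g] by (simp add: co_zero)
      qed
    qed simp
  qed
  have K_all: "K x y = 0" if "x \<in> V" "y \<in> V" for x y
  proof -
    have lin1: "linear_on V (\<lambda>y. K x y)" if "x \<in> V" for x
      using that by (auto simp: linear_on_def K_def h_simps S hV vec.scale_right_diff_distrib)
    have lin2: "linear_on V (\<lambda>x. K x y)" if "y \<in> V" for y
      using that by (auto simp: linear_on_def K_def h_simps S hV vec.scale_right_diff_distrib)
    have "K (E a) y = 0" if "a \<in> I" for a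
      using linear_on_vanish[OF lin1[OF E_in[OF that]]] K0 that \<open>y \<in> V\<close> by blast
    then show ?thesis using linear_on_vanish[OF lin2[OF \<open>y \<in> V\<close>]] \<open>x \<in> V\<close> by blast
  qed
  have "invariant T \<eta>"
    unfolding invariant_def
  proof (intro ballI)
    fix x y assume "x \<in> V" "y \<in> V"
    then show "br T (\<eta> x y) = \<eta> (br T x) y + \<eta> x (br T y)"
      using LK[of x y] K_all[of x y] by (simp add: algebra_simps)
  qed
  then show ?thesis using that f by (simp add: \<eta>_def)
qed

end

section \<open>The Lie algebra structure of the central extension\<close>

text \<open>
  The number \<open>n = 2 l\<close> is the largest index of the generators \<open>P, Q\<close>, and \<open>N\<close> is the integer
  part of \<open>l\<close>.
\<close>
locale galilei =
  fixes l :: real and n N :: nat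
  assumes l: "l = 1/2 + real N" and n: "n = 2 * N + 1"
begin

abbreviation "B \<equiv> cga_basis l"
abbreviation "V \<equiv> cga_hat l"
abbreviation "br \<equiv> cga_bracket l"
abbreviation "\<beta> \<equiv> cga_b l"

lemma twice_l: "twice l = n"
proof -
  have "2 * l = real n" by (simp add: l n)
  then show ?thesis by (simp add: twice_def)
qed

lemma of_real_l: "complex_of_real l = of_nat n / 2"
  by (simp add: l n field_simps)

lemma \<beta>_eq: "\<beta> m = (-1) ^ (m + N + 1) * fact (n - m) * fact m"
proof -
  have "real m + l + 1/2 = real (m + N + 1)" by (simp add: l)
  then have "nat \<lfloor>real m + l + 1/2\<rfloor> = m + N + 1" by (metis floor_of_nat nat_int)
  then show ?thesis by (simp add: cga_b_def twice_l)
qed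

lemma \<beta>_nonzero: "\<beta> m \<noteq> 0"
  by (simp add: \<beta>_eq)

text \<open>
  This recursion is the invariance of the pairing \<open>P\<^sub>m, P\<^bsub>n-m\<^esub> \<mapsto> \<beta> m\<close> under \<open>H\<close> and \<open>C\<close>.
\<close>
lemma \<beta>_Suc:
  assumes "m + k + 1 = n"
  shows "of_nat (Suc m) * \<beta> m = - of_nat (Suc k) * \<beta> (Suc m)"
proof -
  have "n - m = Suc k" "n - Suc m = k" using assms by auto
  then show ?thesis by (simp add: \<beta>_eq algebra_simps)
qed

text \<open>
  The sign changes because \<open>n\<close> is odd, so the pairing is alternating.
\<close>
lemma \<beta>_swap: "m + k = n \<Longrightarrow> \<beta> k = - \<beta> m"
proof -
  assume mk: "m + k = n"
  then have "n - m = k" "n - k = m" "even (k + N + 1) \<longleftrightarrow> odd (m + N + 1)"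
    using n by presburger+
  then show ?thesis by (cases "even (m + N + 1)") (simp_all add: \<beta>_eq minus_one_power_iff)
qed

lemma in_B [simp]:
  "gC \<in> B" "gD \<in> B" "gH \<in> B" "gM12 \<in> B" "gM \<in> B"
  "gP k \<in> B \<longleftrightarrow> k \<le> n" "gQ k \<in> B \<longleftrightarrow> k \<le> n"
  by (auto simp: cga_basis_def twice_l)

lemma finite_B [simp]: "finite B"
  by (simp add: cga_basis_def)

lemma sum_B:
  fixes f :: "cga_gen \<Rightarrow> 'b :: comm_monoid_add"
  shows "sum f B = f gC + f gD + f gH + f gM12 + f gM + (\<Sum>k\<le>n. f (gP k)) + (\<Sum>k\<le>n. f (gQ k))"
proof -
  have "sum f B = sum f {gC, gD, gH, gM12, gM} + sum f (gP ` {..n}) + sum f (gQ ` {..n})"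
    unfolding cga_basis_def twice_l atLeast0AtMost
    by (subst sum.union_disjoint; (subst sum.union_disjoint)?) auto
  then show ?thesis by (simp add: sum.reindex inj_on_def add.assoc)
qed

lemma subspace_V: "vec.subspace V"
  by (simp add: vec.subspace_def cga_hat_def vscale_def)

lemma bvec_V [simp]: "bvec g \<in> V \<longleftrightarrow> g \<in> B"
  by (auto simp: cga_hat_def bvec_def)

lemma expand_bvec: "x \<in> V \<Longrightarrow> x = (\<Sum>g\<in>B. vscale (x g) (bvec g))"
proof
  fix h assume x: "x \<in> V"
  have *: "(\<Sum>g\<in>A. F g) h = (\<Sum>g\<in>A. F g h)" for F :: "cga_gen \<Rightarrow> cga_gen \<Rightarrow> complex" and A
    by (induction A rule: infinite_finite_induct) auto
  show "x h = (\<Sum>g\<in>B. vscale (x g) (bvec g)) h"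
    using x unfolding * by (auto simp: vscale_def bvec_def cga_hat_def if_distrib cong: if_cong)
qed

lemma vscale_apply: "vscale c x g = c * x g"
  by (simp add: vscale_def)

text \<open>
  The bracket is a sum over the basis and hence bilinear on the whole function type.
\<close>
lemma br_bilinear:
  "br (x + y) z = br x z + br y z" "br x (y + z) = br x y + br x z"
  "br (vscale c x) y = vscale c (br x y)" "br x (vscale c y) = vscale c (br x y)"
  by (simp_all add: cga_bracket_def algebra_simps sum.distrib vec.scale_sum_right mult_ac vscale_apply)

lemma br_negative: "br (- x) y = - br x y" "br x (- y) = - br x y" "br 0 y = 0" "br x 0 = 0"
  using br_bilinear(3)[of "-1" x y] br_bilinear(4)[of x "-1" y]
    br_bilinear(3)[of 0 0 y] br_bilinear(4)[of x 0 0] by simp_all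

lemma br_diff: "br (x - y) z = br x z - br y z" "br x (y - z) = br x y - br x z"
  using br_bilinear(1)[of x "- y" z] br_bilinear(2)[of x y "- z"] by (simp_all add: br_negative)

lemma br_bvec: "br (bvec g) (bvec h) = (if g \<in> B \<and> h \<in> B then cga_gen_bracket l g h else 0)"
proof -
  have "br (bvec g) (bvec h)
    = (\<Sum>a\<in>B. \<Sum>b\<in>B. if b = h then if a = g then cga_gen_bracket l a b else 0 else 0)"
    unfolding cga_bracket_def by (intro sum.cong refl) (simp add: bvec_def)
  then show ?thesis by (cases "h \<in> B") simp_all
qed

text \<open>
  The only delicate case is \<open>[C, P\<^sub>n]\<close> (and \<open>[C, Q\<^sub>n]\<close>), where the generator outside the basis has
  coefficient 0.
\<close>
lemma gen_bracket_closed: "g \<in> B \<Longrightarrow> h \<in> B \<Longrightarrow> cga_gen_bracket l g h \<in> V"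
proof -
  note S = vec.subspace_neg[OF subspace_V] vec.subspace_scale[OF subspace_V] vec.subspace_0[OF subspace_V]
  assume "g \<in> B" "h \<in> B"
  moreover have "vscale (of_nat n - of_nat i) (bvec (gP (Suc i))) \<in> V"
    "vscale (of_nat n - of_nat i) (bvec (gQ (Suc i))) \<in> V"
    "vscale (of_nat i - of_nat n) (bvec (gP (Suc i))) \<in> V"
    "vscale (of_nat i - of_nat n) (bvec (gQ (Suc i))) \<in> V" if "i \<le> n" for i
    using that by (cases "i = n"; simp add: S)+
  ultimately show ?thesis
    by (cases g; cases h) (simp_all add: of_real_l S twice_l)
qed

lemma gen_bracket_swap:
  "g \<in> B \<Longrightarrow> h \<in> B \<Longrightarrow> cga_gen_bracket l g h = - cga_gen_bracket l h g"
  by (cases g; cases h) (auto simp: twice_l add.commute \<beta>_swap vec.scale_left_diff_distrib)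

lemma br_swap_all: "br x y = - br y x"
proof -
  have "br x y = (\<Sum>h\<in>B. \<Sum>g\<in>B. vscale (x g * y h) (cga_gen_bracket l g h))"
    unfolding cga_bracket_def by (rule sum.swap)
  also have "\<dots> = (\<Sum>h\<in>B. \<Sum>g\<in>B. - vscale (y h * x g) (cga_gen_bracket l h g))"
  proof (intro sum.cong refl)
    fix g h assume "g \<in> B" "h \<in> B"
    then show "vscale (x g * y h) (cga_gen_bracket l g h)
      = - vscale (y h * x g) (cga_gen_bracket l h g)"
      by (simp only: gen_bracket_swap[of g h] vec.scale_minus_right mult.commute)
  qed
  also have "\<dots> = - br y x"
    unfolding cga_bracket_def sum_negf ..
  finally show ?thesis .
qed

text \<open>
  The action of \<open>sl\<^sub>2\<close> on the Heisenberg part preserves the form with values in the centre. This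
  is the only part of the Jacobi identity that depends on the values of \<open>cga_b\<close> and not just on
  their antisymmetry.
\<close>
lemma form_invariant:
  assumes "A \<in> {gC, gD, gH}" "X \<in> {gP, gQ}" "x \<le> n" "y \<le> n"
  shows "br (cga_gen_bracket l A (X x)) (bvec (X y)) + br (bvec (X x)) (cga_gen_bracket l A (X y)) = 0"
proof -
  have H: "br (cga_gen_bracket l gH (X x)) (bvec (X y)) + br (bvec (X x)) (cga_gen_bracket l gH (X y)) = 0"
  proof (cases x; cases y)
    fix x' y' assume [simp]: "x = Suc x'" "y = Suc y'"
    show ?thesis
      using assms(2-) \<beta>_Suc[of x' y']
      by (auto simp: br_bilinear br_negative br_bvec twice_l vec.scale_left_distrib[symmetric] simp del: of_nat_Suc)
  qed (use assms(2-) n in \<open>auto simp: br_bilinear br_negative br_bvec twice_l\<close>)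
  have C: "br (cga_gen_bracket l gC (X x)) (bvec (X y)) + br (bvec (X x)) (cga_gen_bracket l gC (X y)) = 0"
  proof (cases "x + y + 1 = n")
    case True
    have nx: "complex_of_nat n - of_nat x = of_nat (Suc y)" "complex_of_nat n - of_nat y = of_nat (Suc x)"
      by (simp_all flip: True)
    have "(complex_of_nat n - of_nat x) * \<beta> (Suc x) + (of_nat n - of_nat y) * \<beta> x = 0"
      using \<beta>_Suc[OF True] unfolding nx by (simp add: algebra_simps)
    then show ?thesis
      using assms(2-) True
      by (elim insertE emptyE) (simp_all add: br_bilinear br_negative br_bvec twice_l of_real_l
          vec.scale_left_distrib[symmetric])
  next
    case False
    then show ?thesis
      using assms(2-) by (auto simp: br_bilinear br_negative br_bvec twice_l of_real_l)
  qed
  have D: "br (cga_gen_bracket l gD (X x)) (bvec (X y)) + br (bvec (X x)) (cga_gen_bracket l gD (X y)) = 0"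
  proof (cases "x + y = n")
    case True
    show ?thesis
      using assms(2-)
      by (auto simp: br_bilinear br_negative br_bvec twice_l of_real_l vec.scale_left_distrib[symmetric] simp flip: True)
        (auto simp: field_simps)
  next
    case False
    then show ?thesis
      using assms(2-) by (auto simp: br_bilinear br_negative br_bvec twice_l of_real_l)
  qed
  show ?thesis using assms(1) C D H by blast
qed

text \<open>
  Triples with two generators of the same kind \<open>P\<close> or \<open>Q\<close> and one from \<open>sl\<^sub>2\<close> are covered by the
  invariance of the form, in three positions. All other triples reduce to identities between
  scalar multiples of a single generator.
\<close>
lemma gen_jacobi:
  assumes "g \<in> B" "h \<in> B" "k \<in> B"
  shows "br (bvec g) (cga_gen_bracket l h k)
    = br (cga_gen_bracket l g h) (bvec k) + br (bvec h) (cga_gen_bracket l g k)"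
proof -
  have m: "br (bvec g) (bvec gM) = 0" "br (bvec gM) (bvec g) = 0" for g
    by (cases g; simp add: br_bvec)+
  \<comment> \<open>The next two facts resolve the boundary indices \<open>0\<close> and \<open>n\<close>.\<close>
  have i: "Suc x \<le> n \<longleftrightarrow> x \<noteq> n" "x - Suc 0 \<le> n" if "x \<le> n" for x
    using that by auto
  have p: "of_nat (x - Suc 0) = (if x = 0 then 0 else of_nat x - 1 :: complex)"
    "Suc (x - Suc 0) = (if x = 0 then Suc 0 else x)" for x
    by (cases x; simp)+
  have PP: "br (bvec A) (cga_gen_bracket l (X x) (X y))
    = br (cga_gen_bracket l A (X x)) (bvec (X y)) + br (bvec (X x)) (cga_gen_bracket l A (X y))"
    "br (bvec (X x)) (cga_gen_bracket l A (X y))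
    = br (cga_gen_bracket l (X x) A) (bvec (X y)) + br (bvec A) (cga_gen_bracket l (X x) (X y))"
    "br (bvec (X x)) (cga_gen_bracket l (X y) A)
    = br (cga_gen_bracket l (X x) (X y)) (bvec A) + br (bvec (X y)) (cga_gen_bracket l (X x) A)"
    if "X x \<in> B" "X y \<in> B" and AX: "A \<in> {gC, gD, gH}" "X \<in> {gP, gQ}" for A X x y
  proof -
    have xy: "x \<le> n" "y \<le> n" using that by auto
    have 0: "br (bvec A) (cga_gen_bracket l (X x) (X y)) = 0" "br (cga_gen_bracket l (X x) (X y)) (bvec A) = 0"
      using AX by (auto simp: m br_bilinear br_negative)
    have s: "cga_gen_bracket l (X z) A = - cga_gen_bracket l A (X z)" if "z \<le> n" for z
      using AX that by (intro gen_bracket_swap) auto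
    note inv = form_invariant[OF AX xy]
    show "br (bvec A) (cga_gen_bracket l (X x) (X y))
      = br (cga_gen_bracket l A (X x)) (bvec (X y)) + br (bvec (X x)) (cga_gen_bracket l A (X y))"
      by (simp only: inv 0)
    show "br (bvec (X x)) (cga_gen_bracket l A (X y))
    = br (cga_gen_bracket l (X x) A) (bvec (X y)) + br (bvec A) (cga_gen_bracket l (X x) (X y))"
      using inv unfolding 0 s[OF xy(1)] br_negative by (simp add: eq_neg_iff_add_eq_0 add.commute)
    show "br (bvec (X x)) (cga_gen_bracket l (X y) A)
    = br (cga_gen_bracket l (X x) (X y)) (bvec A) + br (bvec (X y)) (cga_gen_bracket l (X x) A)"
      using inv unfolding 0 s[OF xy(1)] s[OF xy(2)] br_negative
        br_swap_all[of "bvec (X y)" "cga_gen_bracket l A (X x)"]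
      by (simp add: add_eq_0_iff)
  qed
  show ?thesis
    using assms
    by (cases g; cases h; cases k; hypsubst)
      ((rule PP[where X = gP] PP[where X = gQ]; simp; fail)
      | (simp add: m i p br_bilinear br_negative br_bvec of_real_l twice_l; fail)
      | (simp add: m i p br_bilinear br_negative br_bvec of_real_l twice_l,
         simp add: fun_eq_iff vscale_def algebra_simps; fail)
      | (simp add: m i p br_bilinear br_negative br_bvec of_real_l twice_l,
         auto simp: add.commute \<beta>_swap; fail))+
qed

lemma linear_on_vanish_bvec:
  assumes f: "linear_on V f" and 0: "\<And>g. g \<in> B \<Longrightarrow> f (bvec g) = 0" and x: "x \<in> V"
  shows "f x = 0"
proof -
  have "f x = (\<Sum>g\<in>B. f (vscale (x g) (bvec g)))"
    using linear_on_sum[OF f subspace_V, of B "\<lambda>g. vscale (x g) (bvec g)"] expand_bvec[OF x]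
      vec.subspace_scale[OF subspace_V] by simp
  also have "\<dots> = (\<Sum>g\<in>B. 0)"
    by (intro sum.cong refl) (simp add: linear_on_scale[OF f subspace_V] 0)
  finally show ?thesis by simp
qed

text \<open>
  For arguments outside \<open>V\<close> this holds as well, since the bracket reads off only their
  coordinates in the basis.
\<close>
lemma br_V: "br x y \<in> V"
  unfolding cga_bracket_def
  by (intro vec.subspace_sum vec.subspace_scale subspace_V gen_bracket_closed)

lemma jacobi_V:
  assumes "x \<in> V" "y \<in> V" "z \<in> V"
  shows "br x (br y z) = br (br x y) z + br y (br x z)"
proof -
  define J where "J x y z = br x (br y z) - br (br x y) z - br y (br x z)" for x y z
  have "linear_on V (\<lambda>x. J x y z)" "linear_on V (\<lambda>y. J x y z)" "linear_on V (\<lambda>z. J x y z)" for x y z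
    by (simp_all add: linear_on_def J_def br_bilinear vec.scale_right_diff_distrib)
  note vanish = this[THEN linear_on_vanish_bvec]
  have "J (bvec g) (bvec h) (bvec k) = 0" if "g \<in> B" "h \<in> B" "k \<in> B" for g h k
    using gen_jacobi[OF that] that by (simp add: J_def br_bvec)
  then have "J x y z = 0"
    by (intro vanish(1)[OF _ assms(1)] vanish(2)[OF _ assms(2)] vanish(3)[OF _ assms(3)])
  then show ?thesis by (simp add: J_def algebra_simps)
qed

sublocale lie_algebra_on V br
proof
  show "br x x = 0" for x
    using br_swap_all[of x x] by (auto simp: fun_eq_iff)
qed (rule subspace_V br_V jacobi_V | simp add: linear_on_def br_bilinear)+

section \<open>A basis of common eigenvectors of the Cartan subalgebra\<close>

text \<open>
  The common eigenvectors of \<open>D\<close> and the rotation in the span of \<open>P\<^sub>k, Q\<^sub>k\<close> arise for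
  \<open>s * s = -1\<close>.
\<close>
definition Xv :: "complex \<Rightarrow> nat \<Rightarrow> cga_gen \<Rightarrow> complex" where
  "Xv s k = bvec (gP k) + vscale s (bvec (gQ k))"

text \<open>
  The index set of the new basis is again \<open>cga_gen\<close>, where \<open>gP k\<close> now stands for the eigenvector
  with \<open>s = \<i>\<close> and \<open>gQ k\<close> for the one with \<open>s = - \<i>\<close>.
\<close>
fun E :: "cga_gen \<Rightarrow> cga_gen \<Rightarrow> complex" where
  "E (gP k) = Xv \<i> k"
| "E (gQ k) = Xv (- \<i>) k"
| "E g = bvec g"

fun co :: "cga_gen \<Rightarrow> (cga_gen \<Rightarrow> complex) \<Rightarrow> complex" where
  "co (gP k) x = (x (gP k) - \<i> * x (gQ k)) / 2"
| "co (gQ k) x = (x (gP k) + \<i> * x (gQ k)) / 2"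
| "co g x = x g"

text \<open>
  The real part is the weight under \<open>D\<close> and the imaginary part stems from the rotation, so one
  complex number records both.
\<close>
fun wt :: "cga_gen \<Rightarrow> complex" where
  "wt (gP k) = of_nat n - 2 * of_nat k + \<i>"
| "wt (gQ k) = of_nat n - 2 * of_nat k - \<i>"
| "wt gH = 2"
| "wt gC = -2"
| "wt _ = 0"

lemma E_V: "g \<in> B \<Longrightarrow> E g \<in> V"
  by (cases g) (simp_all add: Xv_def)

lemma eigenvector_X:
  assumes "k \<le> n" "s * s = -1"
  shows "br (bvec gD + bvec gM12) (Xv s k) = vscale (of_nat n - 2 * of_nat k + s) (Xv s k)"
proof -
  have "vscale s (bvec (gP k)) + - bvec (gQ k) = vscale s (Xv s k)"
    using assms(2) by (simp add: Xv_def vec.scale_right_distrib)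
  then show ?thesis
    using assms(1) by (simp add: Xv_def br_bilinear br_bvec of_real_l algebra_simps)
qed

lemma eigenvector: "g \<in> B \<Longrightarrow> br (bvec gD + bvec gM12) (E g) = vscale (wt g) (E g)"
  by (cases g) (simp_all add: eigenvector_X[unfolded br_bilinear] br_bilinear br_bvec)

lemma co_E_V: "g \<in> B \<Longrightarrow> h \<in> B \<Longrightarrow> co g (E h) = (if g = h then 1 else 0)"
  by (cases g; cases h) (auto simp: Xv_def bvec_def vscale_def)

lemma expand_E:
  assumes x: "x \<in> V" shows "x = (\<Sum>g\<in>B. vscale (co g x) (E g))"
proof -
  have P: "vscale (co (gP k) x) (E (gP k)) + vscale (co (gQ k) x) (E (gQ k))
    = vscale (x (gP k)) (bvec (gP k)) + vscale (x (gQ k)) (bvec (gQ k))" for k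
    by (rule ext) (simp add: Xv_def vscale_def field_simps)
  have "(\<Sum>g\<in>B. vscale (co g x) (E g)) = (\<Sum>g\<in>B. vscale (x g) (bvec g))"
    unfolding sum_B by (simp only: add.assoc sum.distrib[symmetric] P E.simps(3-7) co.simps(3-7))
  then show ?thesis using expand_bvec[OF x] by simp
qed

text \<open>
  A single diagonalisable element suffices in place of the torus spanned by \<open>D\<close> and \<open>M\<^sub>1\<^sub>2\<close>,
  because no nonzero weights of the two can cancel each other.
\<close>
sublocale eigenbasis V br "bvec gD + bvec gM12" B E co wt
proof
  show "co g (x + y) = co g x + co g y" for g x y
    by (cases g) (simp_all add: field_simps)
  show "co g (vscale c x) = c * co g x" for g c x
    by (cases g) (simp_all add: vscale_def algebra_simps)
qed (simp_all add: E_V eigenvector co_E_V expand_E[symmetric])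

abbreviation "H \<equiv> bvec gH"
abbreviation "D \<equiv> bvec gD"
abbreviation "C \<equiv> bvec gC"
abbreviation "R \<equiv> bvec gM12"
abbreviation "M \<equiv> bvec gM"
abbreviation "T \<equiv> D + R"

text \<open>
  The simplifier collects \<open>v + v\<close> into \<open>2 * v\<close> with the pointwise product of functions. This
  rule returns to scalar multiples.
\<close>
lemma vscale_two [simp]: "2 * vscale c x = vscale (2 * c) x"
  by (rule ext) (simp add: vscale_def)

lemma X_V [simp]: "k \<le> n \<Longrightarrow> Xv s k \<in> V"
  by (simp add: Xv_def)

lemma nonzero [simp]: "bvec g \<noteq> 0" "Xv s k \<noteq> 0"
proof -
  have "bvec g g = 1" "Xv s k (gP k) = 1" for g s k
    by (simp_all add: bvec_def Xv_def vscale_def)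
  then show "bvec g \<noteq> 0" "Xv s k \<noteq> 0" by (metis zero_fun_apply zero_neq_one)+
qed

lemma apply_bvec: "bvec g h = (if h = g then 1 else 0)"
  by (simp add: bvec_def)

lemma apply_X:
  "Xv s k (gP j) = (if j = k then 1 else 0)"
  "Xv s k gD = 0" "Xv s k gM12 = 0" "Xv s k gM = 0" "Xv s k gH = 0" "Xv s k gC = 0"
  by (simp_all add: Xv_def vscale_def apply_bvec)

lemma brackets_levi:
  "br H D = vscale (-2) H" "br H C = - D" "br H H = 0" "br H R = 0" "br H M = 0"
  "br D H = vscale 2 H" "br D C = vscale (-2) C" "br D D = 0" "br D R = 0" "br D M = 0"
  "br C H = D" "br C D = vscale 2 C" "br C C = 0" "br C R = 0" "br C M = 0"
  "br R H = 0" "br R D = 0" "br R C = 0" "br R R = 0" "br R M = 0"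
  "br M H = 0" "br M D = 0" "br M C = 0" "br M R = 0" "br M M = 0"
  by (simp_all add: br_bvec)

lemma brackets_X:
  assumes k: "k \<le> n"
  shows "br H (Xv s k) = vscale (- of_nat k) (Xv s (k - 1))"
    and "br D (Xv s k) = vscale (of_nat n - 2 * of_nat k) (Xv s k)"
    and "k < n \<Longrightarrow> br C (Xv s k) = vscale (of_nat n - of_nat k) (Xv s (Suc k))"
    and "k = n \<Longrightarrow> br C (Xv s k) = 0"
    and "s * s = -1 \<Longrightarrow> br R (Xv s k) = vscale s (Xv s k)"
    and "br M (Xv s k) = 0"
proof -
  show "s * s = -1 \<Longrightarrow> br R (Xv s k) = vscale s (Xv s k)"
    using k by (simp add: Xv_def br_bilinear br_bvec vec.scale_right_distrib)
qed (use k in \<open>simp_all add: Xv_def br_bilinear br_bvec of_real_l algebra_simps\<close>)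

lemma brackets_X':
  assumes "k \<le> n"
  shows "br (Xv s k) H = vscale (of_nat k) (Xv s (k - 1))"
    and "br (Xv s k) D = vscale (2 * of_nat k - of_nat n) (Xv s k)"
    and "k < n \<Longrightarrow> br (Xv s k) C = vscale (of_nat k - of_nat n) (Xv s (Suc k))"
    and "s * s = -1 \<Longrightarrow> br (Xv s k) R = vscale (- s) (Xv s k)"
    and "br (Xv s k) M = 0"
  using brackets_X[OF assms, of s]
  by (simp_all add: br_swap_all[of "Xv s k" "bvec _"] flip: vec.scale_minus_left)

lemma brackets_XX:
  assumes "k \<le> n" "j \<le> n" "s * s = -1"
  shows "br (Xv s k) (Xv s j) = 0"
    and "br (Xv s k) (Xv (- s) j) = (if k + j = n then vscale (2 * \<beta> k) M else 0)"
proof -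
  show "br (Xv s k) (Xv s j) = 0"
    "br (Xv s k) (Xv (- s) j) = (if k + j = n then vscale (2 * \<beta> k) M else 0)"
    using assms by (simp_all add: Xv_def br_bilinear br_diff br_bvec twice_l)
qed

text \<open>
  In the following lemmas an eigenvector of a given weight is recovered from its values at
  generators. The value at \<open>gP k\<close> is the coefficient of \<open>Xv s k\<close>, for either sign of \<open>s\<close>.
\<close>
lemma weight_zero:
  assumes "v \<in> V" "br T v = 0"
  shows "v = vscale (v gD) D + vscale (v gM12) R + vscale (v gM) M"
proof -
  have "v = (\<Sum>g\<in>{gD, gM12, gM}. vscale (co g v) (E g))"
  proof (rule eigenvector_expand[where c = 0])
    fix g show "g \<in> B \<Longrightarrow> wt g = 0 \<Longrightarrow> g \<in> {gD, gM12, gM}"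
      by (cases g) (auto simp: complex_eq_iff)
  qed (use assms in auto)
  then show ?thesis by (simp add: add.assoc)
qed

lemma weight_H:
  assumes "v \<in> V" "br T v = vscale 2 v" shows "v = vscale (v gH) H"
proof -
  have "v = (\<Sum>g\<in>{gH}. vscale (co g v) (E g))"
  proof (rule eigenvector_expand[where c = 2])
    fix g show "g \<in> B \<Longrightarrow> wt g = 2 \<Longrightarrow> g \<in> {gH}"
      by (cases g) (auto simp: complex_eq_iff)
  qed (use assms in auto)
  then show ?thesis by simp
qed

lemma weight_C:
  assumes "v \<in> V" "br T v = vscale (-2) v" shows "v = vscale (v gC) C"
proof -
  have "v = (\<Sum>g\<in>{gC}. vscale (co g v) (E g))"
  proof (rule eigenvector_expand[where c = "-2"])
    fix g show "g \<in> B \<Longrightarrow> wt g = -2 \<Longrightarrow> g \<in> {gC}"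
      by (cases g) (auto simp: complex_eq_iff)
  qed (use assms in auto)
  then show ?thesis by simp
qed

lemma sqrt_minus_one: "s * s = -1 \<longleftrightarrow> s = \<i> \<or> s = - \<i>"
proof
  assume "s * s = -1"
  then have "(s - \<i>) * (s + \<i>) = 0" by (simp add: algebra_simps)
  then show "s = \<i> \<or> s = - \<i>" by (auto simp: eq_neg_iff_add_eq_0)
qed auto

lemma weight_X:
  assumes v: "v \<in> V" "br T v = vscale (of_nat n - 2 * of_nat k + s) v" and k: "k \<le> n" and s: "s * s = -1"
  shows "v = vscale (v (gP k)) (Xv s k)"
proof -
  define h where "h = (if s = \<i> then gP k else gQ k)"
  have Eh: "E h = Xv s k" using s by (auto simp: h_def sqrt_minus_one)
  have "v = (\<Sum>g\<in>{h}. vscale (co g v) (E g))"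
  proof (rule eigenvector_expand[OF v])
    fix g show "g \<in> B \<Longrightarrow> wt g = of_nat n - 2 * of_nat k + s \<Longrightarrow> g \<in> {h}"
      using s unfolding sqrt_minus_one by (cases g) (auto simp: complex_eq_iff h_def)
  qed (use k in \<open>auto simp: h_def\<close>)
  then have *: "v = vscale (co h v) (Xv s k)" by (simp add: Eh)
  then have "v (gP k) = co h v" by (metis apply_X(1) mult.right_neutral vscale_apply)
  then show ?thesis using * by simp
qed

lemma weight_none:
  assumes "v \<in> V" "br T v = vscale c v" "\<And>g. g \<in> B \<Longrightarrow> wt g \<noteq> c" shows "v = 0"
  using eigenvector_expand[OF assms(1,2), of "{}"] assms(3) by auto

section \<open>Vanishing of normalised cocycles\<close>

lemma T_V [simp]: "T \<in> V"
  using T_in by simp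

lemma invariant_weight:
  assumes \<omega>: "\<omega> \<in> C2 V" "invariant T \<omega>" and xy: "x \<in> V" "y \<in> V"
    and "br T x = vscale a x" "br T y = vscale b y"
  shows "br T (\<omega> x y) = vscale (a + b) (\<omega> x y)"
  using assms by (simp add: invariant_def C2_simps[OF \<omega>(1)] vec.scale_left_distrib)

lemma brackets_T:
  "br T H = vscale 2 H" "br T C = vscale (-2) C" "br T D = vscale 0 D" "br T R = vscale 0 R" "br T M = vscale 0 M"
  by (simp_all add: br_bilinear brackets_levi)

text \<open>
  The first normalisation \<open>\<omega> H = 0\<close> makes \<open>\<omega>\<close> invariant under \<open>H\<close>. Invariance connects
  neighbouring indices \<open>k\<close>, so that each sequence of scalars is determined by one of its
  members. Because of the remaining normalisations and finitely many cocycle conditions these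
  members are zero.
\<close>
lemma normalised_cocycle_vanishes:
  assumes n3: "n \<ge> 3" and \<omega>Z: "\<omega> \<in> Z2 V br" and invT: "invariant T \<omega>"
    and \<omega>H: "\<And>x. x \<in> V \<Longrightarrow> \<omega> H x = 0"
    and \<omega>RX: "\<omega> R (Xv \<i> 0) = 0"
    and \<omega>XX: "\<omega> (Xv \<i> 0) (Xv (- \<i>) n) gM12 = 0" "\<omega> (Xv \<i> 0) (Xv (- \<i>) n) gM = 0"
    and \<omega>RM: "\<omega> R M gM = 0"
    and xy: "x \<in> V" "y \<in> V"
  shows "\<omega> x y = 0"
proof -
  note \<omega>2 = Z2_C2[OF \<omega>Z]
  note S = C2_simps[OF \<omega>2]
  note swap = C2_swap[OF \<omega>2]
  note weight = invariant_weight[OF \<omega>2 invT]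
  have inv: "br t (\<omega> x y) = \<omega> (br t x) y + \<omega> x (br t y)"
    if "\<And>x. x \<in> V \<Longrightarrow> \<omega> t x = 0" "t \<in> V" "x \<in> V" "y \<in> V" for t x y
    using cocycle_invariantI[OF \<omega>Z that(2,1)] that(3,4) by (simp add: invariant_def)
  note invH = inv[OF \<omega>H]
  have wX: "br T (Xv s k) = vscale (of_nat n - 2 * of_nat k + s) (Xv s k)" if "k \<le> n" "s * s = -1" for s k
    by (rule eigenvector_X[OF that])

  have DC: "\<omega> D C = 0"
  proof -
    have "br T (\<omega> D C) = vscale (-2) (\<omega> D C)"
      using weight[of D C 0 "-2"] by (simp add: brackets_T)
    from weight_C[OF _ this] obtain c where c: "\<omega> D C = vscale c C" using S(1)[of D C] by auto
    have "br H (vscale c C) = 0"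
      using invH[of D C] c C2_self[OF \<omega>2, of D] \<omega>H[of C] by (simp add: brackets_levi S)
    then show ?thesis by (simp add: c br_bilinear brackets_levi)
  qed
  have YX: "\<omega> Y (Xv s k) = vscale (\<omega> Y (Xv s k) (gP k)) (Xv s k)"
    if "k \<le> n" "s * s = -1" "Y \<in> {D, R, M}" for Y s k
  proof (rule weight_X[OF _ _ that(1,2)])
    show "br T (\<omega> Y (Xv s k)) = vscale (of_nat n - 2 * of_nat k + s) (\<omega> Y (Xv s k))"
      using that weight[of Y "Xv s k" 0] wX[OF that(1,2)] by (auto simp: brackets_T)
  qed (use that S in auto)
  \<comment> \<open>\<open>H\<close> lowers the index, so invariance under \<open>H\<close> makes the coefficients independent of \<open>k\<close>.\<close>
  have YX_const: "\<omega> Y (Xv s k) = vscale (\<omega> Y (Xv s 0) (gP 0)) (Xv s k)"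
    if k: "k \<le> n" and s: "s * s = -1" and Y: "Y \<in> {D, R, M}" for Y s k
    using k
  proof (induction k)
    case 0
    show ?case using YX[OF _ s Y, of 0] by simp
  next
    case (Suc k)
    define w where "w = \<omega> Y (Xv s (Suc k)) (gP (Suc k))"
    have *: "\<omega> Y (Xv s (Suc k)) = vscale w (Xv s (Suc k))"
      unfolding w_def using YX[OF Suc.prems s Y] .
    have YV: "Y \<in> V" using Y by auto
    have "br H Y = 0 \<or> br H Y = vscale (-2) H" using Y by (auto simp: brackets_levi)
    then have "\<omega> (br H Y) (Xv s (Suc k)) = 0"
      using Suc.prems \<omega>H[of "Xv s (Suc k)"] by (auto simp: S)
    then have "br H (vscale w (Xv s (Suc k))) = vscale (- of_nat (Suc k)) (\<omega> Y (Xv s k))"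
      using invH[of Y "Xv s (Suc k)"] YV Suc.prems by (simp add: * S brackets_X del: of_nat_Suc)
    then have "vscale (w * of_nat (Suc k)) (Xv s k)
      = vscale (of_nat (Suc k) * \<omega> Y (Xv s 0) (gP 0)) (Xv s k)"
      using Suc by (simp add: br_bilinear brackets_X del: of_nat_Suc)
    then have "w = \<omega> Y (Xv s 0) (gP 0)"
      by (simp del: of_nat_Suc)
    then show ?case using * by simp
  qed
  \<comment> \<open>Let \<open>w\<close> be the constant for \<open>Y = D\<close>. Invariance also gives the coefficient \<open>w\<close> for each
      \<open>\<omega> C X\<^sub>k\<close> with \<open>k < n\<close>. At the end of the string there is no vector \<open>X\<^bsub>n+1\<^esub>\<close>, so that
      \<open>\<omega> C X\<^sub>n = 0\<close>, and this forces \<open>(n + 1) w = 0\<close>.\<close>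
  have DX_CX: "\<omega> D (Xv s k) = 0 \<and> \<omega> C (Xv s k) = 0" if k: "k \<le> n" and s: "s * s = -1" for s k
  proof -
    define w where "w = \<omega> D (Xv s 0) (gP 0)"
    have D: "\<omega> D (Xv s k) = vscale w (Xv s k)" if "k \<le> n" for k
      unfolding w_def using YX_const[OF that s] by simp
    have rec: "br H (\<omega> C (Xv s k)) = - vscale w (Xv s k) - vscale (of_nat k) (\<omega> C (Xv s (k - 1)))"
      if "k \<le> n" for k
      using invH[of C "Xv s k"] that D[OF that] by (simp add: S brackets_levi brackets_X)
    have C: "\<omega> C (Xv s k) = vscale w (Xv s (Suc k))" if "k < n" for k
      using that
    proof (induction k)
      case 0
      define v where "v = \<omega> C (Xv s 0) (gP 1)"
      have v: "\<omega> C (Xv s 0) = vscale v (Xv s 1)"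
        unfolding v_def
      proof (rule weight_X[OF _ _ _ s])
        show "br T (\<omega> C (Xv s 0)) = vscale (of_nat n - 2 * of_nat 1 + s) (\<omega> C (Xv s 0))"
          using weight[of C "Xv s 0" "-2" "of_nat n + s"] wX[of 0 s] s by (simp add: brackets_T algebra_simps)
      qed (use 0 S in auto)
      then show ?case
        using rec[of 0] 0 by (simp add: br_bilinear brackets_X)
    next
      case (Suc k)
      define v where "v = \<omega> C (Xv s (Suc k)) (gP (Suc (Suc k)))"
      have v: "\<omega> C (Xv s (Suc k)) = vscale v (Xv s (Suc (Suc k)))"
        unfolding v_def
      proof (rule weight_X[OF _ _ _ s])
        show "br T (\<omega> C (Xv s (Suc k)))
          = vscale (of_nat n - 2 * of_nat (Suc (Suc k)) + s) (\<omega> C (Xv s (Suc k)))"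
          using weight[of C "Xv s (Suc k)" "-2" "of_nat n - 2 * of_nat (Suc k) + s"] wX[of "Suc k" s] s Suc.prems
          by (simp add: brackets_T algebra_simps)
      qed (use Suc S in auto)
      have "vscale (v * of_nat (Suc (Suc k))) (Xv s (Suc k))
        = vscale (w * of_nat (Suc (Suc k))) (Xv s (Suc k))"
        using rec[of "Suc k"] Suc by (simp add: v br_bilinear brackets_X algebra_simps)
      then have "v = w" by (simp del: of_nat_Suc)
      then show ?case using v by simp
    qed
    have C0: "\<omega> C (Xv s n) = 0"
    proof (rule weight_none)
      show "br T (\<omega> C (Xv s n)) = vscale (- 2 + (of_nat n - 2 * of_nat n + s)) (\<omega> C (Xv s n))"
        by (rule weight) (use s wX in \<open>auto simp: brackets_T\<close>)
      fix g show "g \<in> B \<Longrightarrow> wt g \<noteq> - 2 + (of_nat n - 2 * of_nat n + s)"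
        using s unfolding sqrt_minus_one by (cases g) (auto simp: complex_eq_iff)
    qed (use S in simp)
    have "vscale (w * of_nat (Suc n)) (Xv s n) = 0"
      using rec[of n] C[of "n - 1"] C0 n3 by (simp add: br_bilinear brackets_X br_negative algebra_simps)
    then have "w = 0" by (simp del: of_nat_Suc)
    then show ?thesis using D[OF k] C[of k] C0 k by (cases "k = n") auto
  qed
  \<comment> \<open>A multiple \<open>c\<close> of \<open>C\<close> is sent by \<open>H\<close> to \<open>- c D\<close> and then to a multiple of \<open>c H\<close>, which has
      to vanish.\<close>
  have DY_CY: "\<omega> D Y = 0 \<and> \<omega> C Y = 0" if Y: "Y \<in> {R, M}" for Y
  proof -
    have YV: "Y \<in> V" "br T Y = vscale 0 Y" "br H Y = 0"
      using Y by (auto simp: brackets_T brackets_levi)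
    have "br T (\<omega> C Y) = vscale (-2) (\<omega> C Y)"
      using weight[of C Y "-2" 0] YV by (simp add: brackets_T)
    from weight_C[OF _ this] obtain c where c: "\<omega> C Y = vscale c C" using S(1)[of C Y] YV by auto
    have 1: "vscale c D = \<omega> D Y"
      using invH[of C Y] YV c by (simp add: brackets_levi S br_bilinear)
    have "br H (\<omega> D Y) = 0"
      using invH[of D Y] YV \<omega>H[of Y] by (simp add: brackets_levi S)
    then have "c = 0" by (simp add: 1[symmetric] br_bilinear brackets_levi)
    then show ?thesis using 1 c by simp
  qed
  have vanish: "\<omega> t x = 0"
    if "t \<in> V" "\<And>g. g \<in> B \<Longrightarrow> \<omega> t (E g) = 0" "x \<in> V" for t x
    using linear_on_vanish[of "\<omega> t"] \<omega>2 that by (simp add: C2_def)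
  have \<omega>D: "\<omega> D x = 0" if "x \<in> V" for x
  proof (rule vanish[OF _ _ that])
    fix g show "g \<in> B \<Longrightarrow> \<omega> D (E g) = 0"
      using DX_CX DY_CY[of R] DY_CY[of M] swap[of D H] \<omega>H[of D] DC C2_self[OF \<omega>2, of D]
      by (cases g) simp_all
  qed simp
  have \<omega>C: "\<omega> C x = 0" if "x \<in> V" for x
  proof (rule vanish[OF _ _ that])
    fix g show "g \<in> B \<Longrightarrow> \<omega> C (E g) = 0"
      using DX_CX DY_CY[of R] DY_CY[of M] swap[of C H] swap[of C D] \<omega>H[of C] DC C2_self[OF \<omega>2, of C]
      by (cases g) simp_all
  qed simp
  \<comment> \<open>From here on \<open>\<omega>\<close> is invariant under \<open>H\<close> and \<open>C\<close>, and so under all of \<open>sl\<^sub>2\<close>.\<close>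
  note invC = inv[OF \<omega>C]

  define X where "X k = Xv \<i> k" for k
  define Y where "Y k = Xv (- \<i>) k" for k
  have XY_V [simp]: "X k \<in> V" "Y k \<in> V" if "k \<le> n" for k
    using that by (simp_all add: X_def Y_def)
  have bX: "br H (X k) = vscale (- of_nat k) (X (k - 1))"
      "k < n \<Longrightarrow> br C (X k) = vscale (of_nat n - of_nat k) (X (Suc k))"
      "k = n \<Longrightarrow> br C (X k) = 0" "br R (X k) = vscale \<i> (X k)"
    "br H (Y k) = vscale (- of_nat k) (Y (k - 1))"
      "k < n \<Longrightarrow> br C (Y k) = vscale (of_nat n - of_nat k) (Y (Suc k))"
      "k = n \<Longrightarrow> br C (Y k) = 0" "br R (Y k) = vscale (- \<i>) (Y k)"
    if "k \<le> n" for k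
    using brackets_X[OF that, of \<i>] brackets_X[OF that, of "- \<i>"] by (simp_all add: X_def Y_def)
  have bXX: "br (X k) (X j) = 0" "br (Y k) (Y j) = 0"
    "br (X k) (Y j) = (if k + j = n then vscale (2 * \<beta> k) M else 0)"
    "br (Y k) (X j) = (if k + j = n then vscale (2 * \<beta> k) M else 0)"
    if "k \<le> n" "j \<le> n" for j k
    using brackets_XX[OF that, of \<i>] brackets_XX[OF that, of "- \<i>"] by (simp_all add: X_def Y_def)
  have wXY: "br T (\<omega> (X k) (Y j)) = vscale (2 * of_nat n - 2 * of_nat (k + j)) (\<omega> (X k) (Y j))"
    if "k \<le> n" "j \<le> n" for k j
    using weight[of "X k" "Y j" "of_nat n - 2 * of_nat k + \<i>" "of_nat n - 2 * of_nat j - \<i>"]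
      that wX[of k \<i>] wX[of j "-\<i>"]
    by (simp add: X_def Y_def algebra_simps)
  \<comment> \<open>For equal signs the imaginary part of the weight is \<open>\<plusminus> 2\<close>, which does not occur.\<close>
  have same: "\<omega> (Xv s k) (Xv s j) = 0" if "k \<le> n" "j \<le> n" "s * s = -1" for s k j
  proof (rule weight_none)
    show "br T (\<omega> (Xv s k) (Xv s j))
      = vscale ((of_nat n - 2 * of_nat k + s) + (of_nat n - 2 * of_nat j + s)) (\<omega> (Xv s k) (Xv s j))"
      by (rule weight) (use that wX in auto)
    fix g show "g \<in> B \<Longrightarrow> wt g \<noteq> (of_nat n - 2 * of_nat k + s) + (of_nat n - 2 * of_nat j + s)"
      using that(3) unfolding sqrt_minus_one by (cases g) (auto simp: complex_eq_iff)
  qed (use that S in simp)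
  \<comment> \<open>For opposite signs the value has an even real weight. It lies in \<open>\<langle>D, R, M\<rangle>\<close>, \<open>\<langle>H\<rangle>\<close> or
      \<open>\<langle>C\<rangle>\<close> when the indices add up to \<open>n\<close>, \<open>n - 1\<close> or \<open>n + 1\<close>, and is zero otherwise.\<close>
  define a where "a k = \<omega> (X k) (Y (n - k)) gD" for k
  define b where "b k = \<omega> (X k) (Y (n - k)) gM12" for k
  define c where "c k = \<omega> (X k) (Y (n - k)) gM" for k
  define r where "r k = \<omega> (X k) (Y (n - 1 - k)) gH" for k
  define \<sigma> where "\<sigma> k = \<omega> (X k) (Y (n + 1 - k)) gC" for k
  have XY0: "\<omega> (X k) (Y (n - k)) = vscale (a k) D + vscale (b k) R + vscale (c k) M" if "k \<le> n" for k
    unfolding a_def b_def c_def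
  proof (rule weight_zero)
    show "br T (\<omega> (X k) (Y (n - k))) = 0"
      using wXY[of k "n - k"] that by (simp flip: of_nat_diff)
  qed (use that S in simp)
  have XYH: "\<omega> (X k) (Y (n - 1 - k)) = vscale (r k) H" if "k < n" for k
    unfolding r_def
  proof (rule weight_H)
    have "complex_of_nat n = of_nat (k + (n - 1 - k)) + 1" using that by (simp flip: of_nat_Suc of_nat_add)
    then show "br T (\<omega> (X k) (Y (n - 1 - k))) = vscale 2 (\<omega> (X k) (Y (n - 1 - k)))"
      using wXY[of k "n - 1 - k"] that by (simp only: ) (simp add: algebra_simps)
  qed (use that S in simp)
  have XYC: "\<omega> (X k) (Y (n + 1 - k)) = vscale (\<sigma> k) C" if "1 \<le> k" "k \<le> n" for k
    unfolding \<sigma>_def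
  proof (rule weight_C)
    have "complex_of_nat (k + (n + 1 - k)) = of_nat n + 1" using that by (simp flip: of_nat_add)
    then show "br T (\<omega> (X k) (Y (n + 1 - k))) = vscale (-2) (\<omega> (X k) (Y (n + 1 - k)))"
      using wXY[of k "n + 1 - k"] that by (simp only: ) (simp add: algebra_simps)
  qed (use that S in simp)
  have XY_other: "\<omega> (X k) (Y j) = 0" if "k \<le> n" "j \<le> n" "k + j \<notin> {n - 1, n, n + 1}" for k j
  proof (rule weight_none[OF _ wXY[OF that(1,2)]])
    have ne: "int n - int (k + j) \<notin> {-1, 0, 1}" using that n3 by auto
    fix g assume "g \<in> B"
    show "wt g \<noteq> 2 * of_nat n - 2 * of_nat (k + j)"
    proof
      assume eq: "wt g = 2 * of_nat n - 2 * of_nat (k + j)"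
      have "wt g = 2 * of_int (int n - int (k + j))" by (simp add: eq)
      moreover obtain i :: int where i: "i \<in> {-1, 0, 1}" "wt g = 2 * of_int i"
      proof -
        have "wt g \<in> {-2, 0, 2}" using eq by (cases g) (auto simp: complex_eq_iff)
        then show ?thesis using that[of "-1"] that[of 0] that[of 1] by auto
      qed
      ultimately have "complex_of_int (int n - int (k + j)) = of_int i"
        by (metis mult_cancel_left zero_neq_numeral)
      then have "int n - int (k + j) = i" by (simp only: of_int_eq_iff)
      then show False using ne i(1) by simp
    qed
  qed (use that S in simp)

  \<comment> \<open>Invariance under \<open>H\<close> for \<open>X\<^bsub>k+1\<^esub>, Y\<^bsub>n-k\<^esub>\<close>. The components at \<open>R\<close> and \<open>M\<close> are recursions for
      \<open>b\<close> and \<open>c\<close> with initial value 0. The component at \<open>D\<close> expresses \<open>\<sigma>\<close> by \<open>a\<close>.\<close>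
  have recH: "vscale (\<sigma> (Suc k)) D = vscale (of_nat (Suc k)) (\<omega> (X k) (Y (n - k)))
      + vscale (of_nat (n - k)) (\<omega> (X (Suc k)) (Y (n - Suc k)))" if "k < n" for k
  proof -
    have "br H (\<omega> (X (Suc k)) (Y (n - k))) = - vscale (\<sigma> (Suc k)) D"
      using XYC[of "Suc k"] that by (simp add: br_bilinear brackets_levi)
    moreover have "br H (\<omega> (X (Suc k)) (Y (n - k)))
      = \<omega> (br H (X (Suc k))) (Y (n - k)) + \<omega> (X (Suc k)) (br H (Y (n - k)))"
      using that by (intro invH) simp_all
    moreover have "\<omega> (br H (X (Suc k))) (Y (n - k)) = - vscale (of_nat (Suc k)) (\<omega> (X k) (Y (n - k)))"
      using that bX(1)[of "Suc k"] by (simp add: S del: of_nat_Suc)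
    moreover have "\<omega> (X (Suc k)) (br H (Y (n - k)))
      = - vscale (of_nat (n - k)) (\<omega> (X (Suc k)) (Y (n - Suc k)))"
      using that bX(5)[of "n - k"] by (simp add: S del: of_nat_diff)
    ultimately have "- vscale (\<sigma> (Suc k)) D = - (vscale (of_nat (Suc k)) (\<omega> (X k) (Y (n - k)))
      + vscale (of_nat (n - k)) (\<omega> (X (Suc k)) (Y (n - Suc k))))"
      by (simp only: minus_add_distrib)
    then show ?thesis by (simp only: neg_equal_iff_equal)
  qed
  have b0: "b k = 0 \<and> c k = 0" if "k \<le> n" for k
    using that
  proof (induction k)
    case 0
    then show ?case using \<omega>XX by (simp add: b_def c_def X_def Y_def)
  next
    case (Suc k)
    from arg_cong[OF recH, of k "\<lambda>v. v gM12"] arg_cong[OF recH, of k "\<lambda>v. v gM"] Suc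
    show ?case by (auto simp: XY0 vscale_apply apply_bvec)
  qed
  have XYD: "\<omega> (X k) (Y (n - k)) = vscale (a k) D" if "k \<le> n" for k
    using XY0[OF that] b0[OF that] by simp
  have rec1: "\<sigma> (Suc k) = of_nat (Suc k) * a k + of_nat (n - k) * a (Suc k)" if "k < n" for k
    using arg_cong[OF recH[OF that], of "\<lambda>v. v gD"] that by (simp add: XYD vscale_apply apply_bvec)
  \<comment> \<open>Invariance under \<open>C\<close> expresses \<open>a\<close> by \<open>\<sigma>\<close> and \<open>r\<close> by \<open>a\<close>, so it is enough to show \<open>\<sigma> = 0\<close>.
      The value \<open>\<sigma> 0\<close> is meaningless and occurs with coefficient 0 only.\<close>
  have rec2: "2 * a k = of_nat (n - k) * \<sigma> (Suc k) + of_nat k * \<sigma> k" if "k \<le> n" for k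
  proof -
    have 1: "\<omega> (br C (X k)) (Y (n - k)) = vscale (of_nat (n - k) * \<sigma> (Suc k)) C"
      using that XYC[of "Suc k"] by (cases "k = n") (simp_all add: bX S of_nat_diff)
    have 2: "\<omega> (X k) (br C (Y (n - k))) = vscale (of_nat k * \<sigma> k) C"
    proof (cases "k = 0")
      case False
      then have "Suc (n - k) = n + 1 - k" "complex_of_nat n - of_nat (n - k) = of_nat k" using that by auto
      then show ?thesis using False that XYC[of k] by (simp add: bX(6) S)
    qed (simp add: bX S)
    have "vscale (2 * a k) C = vscale (of_nat (n - k) * \<sigma> (Suc k) + of_nat k * \<sigma> k) C"
      using invC[of "X k" "Y (n - k)"] that
      by (simp add: 1 2 XYD br_bilinear brackets_levi mult.commute vec.scale_left_distrib del: of_nat_diff)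
    then show ?thesis by simp
  qed
  have rec3: "r k = of_nat (n - k) * a (Suc k) + of_nat (Suc k) * a k" if "k < n" for k
  proof -
    define j where "j = n - Suc k"
    have j: "j < n" "Suc j = n - k" "n - 1 - k = j" "complex_of_nat n - of_nat j = of_nat (Suc k)"
      using that by (auto simp: j_def of_nat_diff)
    have "br C (\<omega> (X k) (Y j)) = vscale (r k) D"
      using XYH[OF that, unfolded j(3)] by (simp add: br_bilinear brackets_levi)
    moreover have "\<omega> (br C (X k)) (Y j) = vscale (of_nat (n - k) * a (Suc k)) D"
      using that j XYD[of "Suc k"] by (simp add: bX S j_def[symmetric] of_nat_diff)
    moreover have "\<omega> (X k) (br C (Y j)) = vscale (of_nat (Suc k) * a k) D"
      using that j(1,2) XYD[of k] by (simp add: bX S j(4) del: of_nat_Suc)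
    moreover have "br C (\<omega> (X k) (Y j)) = \<omega> (br C (X k)) (Y j) + \<omega> (X k) (br C (Y j))"
      using that j(1) by (intro invC) simp_all
    ultimately have "vscale (r k) D = vscale (of_nat (n - k) * a (Suc k) + of_nat (Suc k) * a k) D"
      by (simp only: vec.scale_left_distrib)
    then show ?thesis by (simp only: vec.scale_cancel_right nonzero simp_thms)
  qed
  \<comment> \<open>In the cocycle condition for \<open>X\<^sub>0, X\<^sub>j, Y\<^bsub>n+1-j\<^esub>\<close> with \<open>j \<ge> 3\<close> the indices of \<open>X\<^sub>0\<close> and \<open>Y\<close> add
      up to at most \<open>n - 2\<close>, so the only surviving term is \<open>[X\<^sub>0, \<sigma> j C]\<close>.\<close>
  have high: "\<sigma> j = 0" if "3 \<le> j" "j \<le> n" for j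
  proof -
    have j: "n + 1 - j \<le> n" "n + 1 - j \<noteq> n" using that by auto
    have "\<omega> (X 0) (Y (n + 1 - j)) = 0" using that by (intro XY_other) auto
    moreover have "\<omega> (X 0) (X j) = 0" using same[of 0 j \<i>] that by (simp add: X_def)
    moreover have "br (X 0) C = vscale (- of_nat n) (X 1)"
      using brackets_X'(3)[of 0 \<i>] n3 by (simp add: X_def)
    ultimately have "vscale (\<sigma> j * of_nat n) (X 1) = 0"
      using Z2_cocycle[OF \<omega>Z, of "X 0" "X j" "Y (n + 1 - j)"] that j XYC[of j]
      by (simp add: bXX br_negative br_bilinear S)
    then show ?thesis using n3 by (simp add: X_def)
  qed
  \<comment> \<open>Eliminating \<open>a\<close> for the indices 0 and 1 leaves two linear equations for \<open>\<sigma> 1\<close> and \<open>\<sigma> 2\<close>,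
      since \<open>\<sigma> 3 = 0\<close>. Their determinant is \<open>3 (n - 1) (n - 2)\<close> up to sign.\<close>
  have s1: "\<sigma> 1 = 0" and s2: "\<sigma> 2 = 0"
  proof -
    define m where "m = complex_of_nat n"
    have nk: "complex_of_nat (n - 1) = m - 1" "complex_of_nat (n - 2) = m - 2"
      using n3 by (simp_all add: m_def of_nat_diff)
    have "2 * \<sigma> 1 = 2 * a 0 + m * (2 * a 1)" using rec1[of 0] n3 by (simp add: m_def)
    also have "2 * a 0 = m * \<sigma> 1" using rec2[of 0] by (simp add: m_def)
    also have "2 * a 1 = (m - 1) * \<sigma> 2 + \<sigma> 1" using rec2[of 1] n3 nk by (simp add: numeral_2_eq_2)
    finally have 1: "2 * \<sigma> 1 = m * \<sigma> 1 + m * ((m - 1) * \<sigma> 2 + \<sigma> 1)" .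
    have "2 * \<sigma> 2 = 2 * (2 * a 1) + (m - 1) * (2 * a 2)"
      using rec1[of 1] n3 nk by (simp add: numeral_2_eq_2)
    also have "2 * a 1 = (m - 1) * \<sigma> 2 + \<sigma> 1" by fact
    also have "2 * a 2 = 2 * \<sigma> 2" using rec2[of 2] n3 nk high[of 3] by (simp add: numeral_3_eq_3 numeral_2_eq_2)
    finally have "2 * \<sigma> 1 = 2 * ((3 - 2 * m) * \<sigma> 2)" by (simp add: algebra_simps)
    then have 2: "\<sigma> 1 = (3 - 2 * m) * \<sigma> 2" by (metis mult_cancel_left zero_neq_numeral)
    have "(m - 1) * (3 * (m - 2) * \<sigma> 2) = 0"
      using 1 unfolding 2 by (simp add: algebra_simps)
    moreover have "m \<noteq> of_nat 1" "m \<noteq> of_nat 2"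
      unfolding m_def of_nat_eq_iff using n3 by simp_all
    ultimately show "\<sigma> 2 = 0" by simp
    then show "\<sigma> 1 = 0" using 2 by simp
  qed
  have \<sigma>0: "\<sigma> k = 0" if "1 \<le> k" "k \<le> n" for k
  proof -
    consider "k = 1" | "k = 2" | "3 \<le> k" using \<open>1 \<le> k\<close> by linarith
    then show ?thesis using s1 s2 high that by cases auto
  qed
  have a0: "a k = 0" if "k \<le> n" for k
  proof -
    have "of_nat (n - k) * \<sigma> (Suc k) = 0" "of_nat k * \<sigma> k = 0"
      using \<sigma>0[of k] \<sigma>0[of "Suc k"] that by (cases "k = n"; cases "k = 0"; simp)+
    then have "2 * a k = 0" unfolding rec2[OF that] by (simp only: add_0_right)
    then show ?thesis by simp
  qed
  have XY: "\<omega> (X k) (Y j) = 0" if kj: "k \<le> n" "j \<le> n" for k j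
  proof -
    consider "k + j = n" | "k + j = n - 1" | "k + j = n + 1" | "k + j \<notin> {n - 1, n, n + 1}" by auto
    then show ?thesis
    proof cases
      case 1
      then have "j = n - k" by simp
      then show ?thesis using XYD[OF kj(1)] a0[OF kj(1)] by simp
    next
      case 2
      then have "k < n" "j = n - 1 - k" using n3 by auto
      then show ?thesis using XYH[of k] rec3[of k] a0[of k] a0[of "Suc k"] by simp
    next
      case 3
      then have "1 \<le> k" "j = n + 1 - k" using kj by auto
      then show ?thesis using XYC[of k] \<sigma>0[of k] kj by simp
    qed (use XY_other kj in auto)
  qed
  have XX: "\<omega> (X k) (X j) = 0" "\<omega> (Y k) (Y j) = 0" "\<omega> (Y k) (X j) = 0" if "k \<le> n" "j \<le> n" for k j
    using same[of k j \<i>] same[of k j "- \<i>"] XY[of j k] swap[of "Y k" "X j"] that by (simp_all add: X_def Y_def)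

  have one: "1 \<le> n" using n3 by simp
  \<comment> \<open>Only \<open>[X\<^sub>0, Y\<^sub>n]\<close> contributes to the cocycle condition for \<open>X\<^sub>0, X\<^sub>1, Y\<^sub>n\<close>, and it is a
      multiple of \<open>M\<close>.\<close>
  have \<omega>MX: "\<omega> M (X k) = 0" if "k \<le> n" for k
  proof -
    have "vscale (2 * \<beta> 0) (\<omega> M (X 1)) = 0"
      using Z2_cocycle[OF \<omega>Z, of "X 0" "X 1" "Y n"] n3 one
      by (simp add: bXX XX XY br_negative br_bilinear S)
    then have "\<omega> M (X 1) = 0" by (simp add: \<beta>_nonzero)
    then have "\<omega> M (X 0) (gP 0) = 0"
      using YX_const[of 1 \<i> M] one by (simp add: X_def)
    then show ?thesis using YX_const[of k \<i> M] that by (simp add: X_def)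
  qed
  have \<omega>MY: "\<omega> M (Y k) = 0" if "k \<le> n" for k
  proof -
    have "vscale (2 * \<beta> 0) (\<omega> M (Y 1)) = 0"
      using Z2_cocycle[OF \<omega>Z, of "Y 0" "Y 1" "X n"] n3 one
      by (simp add: bXX XX XY br_negative br_bilinear S)
    then have "\<omega> M (Y 1) = 0" by (simp add: \<beta>_nonzero)
    then have "\<omega> M (Y 0) (gP 0) = 0"
      using YX_const[of 1 "- \<i>" M] one by (simp add: Y_def)
    then show ?thesis using YX_const[of k "- \<i>" M] that by (simp add: Y_def)
  qed
  have \<omega>RX0: "\<omega> R (X k) = 0" if "k \<le> n" for k
    using YX_const[of k \<i> R] \<omega>RX that by (simp add: X_def)
  define p where "p = \<omega> R (Y 0) (gP 0)"
  have \<omega>RY: "\<omega> R (Y k) = vscale p (Y k)" if "k \<le> n" for k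
    using YX_const[of k "- \<i>" R] that by (simp add: Y_def p_def)
  \<comment> \<open>The cocycle condition for \<open>R, X\<^sub>0, Y\<^sub>n\<close> identifies the scalar of \<open>\<omega> R\<close> on \<open>Y\<close> with its value
      on \<open>M\<close>, where \<open>\<omega>RM\<close> applies.\<close>
  have "vscale (2 * \<beta> 0) (\<omega> R M) = vscale (2 * \<beta> 0) (vscale p M)"
    using Z2_cocycle[OF \<omega>Z, of R "X 0" "Y n"] one swap[of M R]
    by (simp add: bXX bX XY XX \<omega>RX0 \<omega>RY br_negative br_bilinear S mult.commute add_eq_0_iff)
  then have RM: "\<omega> R M = vscale p M" by (simp only: vec.scale_cancel_left) (simp add: \<beta>_nonzero)
  then have p0: "p = 0" using \<omega>RM by (simp add: vscale_apply apply_bvec)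

  have XY_E: "E (gP k) = X k" "E (gQ k) = Y k" for k by (simp_all add: X_def Y_def)
  have \<omega>R: "\<omega> R x = 0" if "x \<in> V" for x
  proof (rule vanish[OF _ _ that])
    fix g show "g \<in> B \<Longrightarrow> \<omega> R (E g) = 0"
      using \<omega>RX0 \<omega>RY RM p0 \<omega>C[of R] \<omega>D[of R] \<omega>H[of R]
        swap[of R C] swap[of R D] swap[of R H] C2_self[OF \<omega>2, of R]
      by (cases g) (simp_all add: XY_E del: E.simps(1,2))
  qed simp
  have \<omega>M: "\<omega> M x = 0" if "x \<in> V" for x
  proof (rule vanish[OF _ _ that])
    fix g show "g \<in> B \<Longrightarrow> \<omega> M (E g) = 0"
      using \<omega>MX \<omega>MY \<omega>C[of M] \<omega>D[of M] \<omega>H[of M] \<omega>R[of M]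
        swap[of M C] swap[of M D] swap[of M H] swap[of M R] C2_self[OF \<omega>2, of M]
      by (cases g) (simp_all add: XY_E del: E.simps(1,2))
  qed simp
  show ?thesis
  proof (rule C2_vanish[OF \<omega>2 _ xy])
    fix g h assume gh: "g \<in> B" "h \<in> B"
    note levi = \<omega>C \<omega>D \<omega>H \<omega>R \<omega>M
    have left: "\<omega> (E g) y = 0" if "g \<notin> range gP \<union> range gQ" "y \<in> V" for g y
      using levi[OF that(2)] that(1) by (cases g) auto
    have right: "\<omega> y (E g) = 0" if "g \<notin> range gP \<union> range gQ" "g \<in> B" "y \<in> V" for g y
      using left[OF that(1,3)] swap[OF that(3) E_in[OF that(2)]] by simp
    show "\<omega> (E g) (E h) = 0"
    proof (cases "g \<in> range gP \<union> range gQ \<and> h \<in> range gP \<union> range gQ")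
      case True
      then show ?thesis using gh XX XY by (auto simp: XY_E simp del: E.simps(1,2))
    next
      case False
      then show ?thesis using left right gh E_in by blast
    qed
  qed
qed

section \<open>The linear functional that detects the cohomology class\<close>

lemma sum_apply: "(\<Sum>g\<in>A. F g) h = (\<Sum>g\<in>A. F g h)"
  for F :: "'b \<Rightarrow> cga_gen \<Rightarrow> complex"
  by (rule additive.sum[of "\<lambda>F. F h"]) (simp add: additive.intro)

lemma br_apply: "br x y k = (\<Sum>g\<in>B. \<Sum>h\<in>B. x g * y h * cga_gen_bracket l g h k)"
  by (simp add: cga_bracket_def sum_apply vscale_apply)

lemma br_gM12: "br x y gM12 = 0"
proof -
  have "cga_gen_bracket l g h gM12 = 0" for g h
    by (cases g; cases h) (simp_all add: vscale_apply apply_bvec)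
  then show ?thesis by (simp add: br_apply)
qed

lemma br_R_gM: "br R y gM = 0"
proof -
  have "R g * y h * cga_gen_bracket l g h gM = 0" for g h
    by (cases g; cases h) (simp_all add: vscale_apply apply_bvec)
  then show ?thesis unfolding br_apply by (intro sum.neutral ballI)
qed

lemma br_M: "br M y = 0"
proof -
  have "M g * y h * cga_gen_bracket l g h k = 0" for g h k
    by (cases g; cases h) (simp_all add: apply_bvec)
  then have "br M y k = 0" for k unfolding br_apply by (intro sum.neutral ballI)
  then show ?thesis by (simp add: fun_eq_iff)
qed

text \<open>
  The eigenvalue of \<open>R\<close> on \<open>M\<close>, to first order along the deformation of the bracket by \<open>\<omega>\<close>.
\<close>
definition \<tau> where "\<tau> \<omega> = \<omega> R M gM"
  for \<omega> :: "(cga_gen \<Rightarrow> complex) \<Rightarrow> (cga_gen \<Rightarrow> complex) \<Rightarrow> (cga_gen \<Rightarrow> complex)"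

lemma \<tau>_d1: "f \<in> C1 V \<Longrightarrow> \<tau> (d1 V br f) = 0"
  by (simp add: \<tau>_def d1_def br_R_gM br_M brackets_levi C1_simps)

text \<open>
  Half of the grading with degrees 1 for \<open>P, Q\<close> and 2 for \<open>M\<close>, so that the witness takes the
  value 1.
\<close>
fun deg :: "cga_gen \<Rightarrow> complex" where
  "deg (gP _) = 1/2"
| "deg (gQ _) = 1/2"
| "deg gM = 1"
| "deg _ = 0"

definition \<delta> where "\<delta> x = (if x \<in> V then (\<lambda>g. deg g * x g) else 0)"

lemma \<delta>_C1: "\<delta> \<in> C1 V"
proof -
  have "\<delta> (x + y) = \<delta> x + \<delta> y" "\<delta> (vscale c x) = vscale c (\<delta> x)" "\<delta> x \<in> V"
    if "x \<in> V" "y \<in> V" for x y c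
    using that by (auto simp: \<delta>_def fun_eq_iff vscale_apply algebra_simps) (simp add: cga_hat_def)
  then show ?thesis
    by (auto simp: C1_def linear_on_def) (simp add: \<delta>_def)
qed

text \<open>
  Each bracket of generators is homogeneous of the sum of their degrees.
\<close>
lemma \<delta>_derivation: "d1 V br \<delta> = 0"
proof -
  have gen: "deg k * cga_gen_bracket l g h k = (deg g + deg h) * cga_gen_bracket l g h k" for g h k
    by (cases g; cases h) (auto simp: vscale_apply apply_bvec)
  have "d1 V br \<delta> x y = 0" if V: "x \<in> V" "y \<in> V" for x y
  proof
    fix k
    have "\<delta> (br x y) k = (\<Sum>g\<in>B. \<Sum>h\<in>B. x g * y h * (deg k * cga_gen_bracket l g h k))"
      using V by (simp add: \<delta>_def br_apply sum_distrib_left mult_ac)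
    also have "\<dots> = br (\<delta> x) y k + br x (\<delta> y) k"
      unfolding gen using V
      by (simp add: \<delta>_def br_apply sum.distrib[symmetric] algebra_simps)
    finally show "d1 V br \<delta> x y k = 0 k"
      using V by (simp add: d1_def br_swap_all[of y])
  qed
  then show ?thesis by (auto simp: fun_eq_iff d1_def)
qed

text \<open>
  The functional \<open>x \<mapsto> x gM12\<close> vanishes on brackets, as the rotation does not occur in any
  bracket.
\<close>
lemma witness: obtains \<omega> where "\<omega> \<in> Z2 V br" "\<tau> \<omega> = 1"
proof
  let ?\<omega> = "\<lambda>x y. if x \<in> V \<and> y \<in> V then vscale (x gM12) (\<delta> y) - vscale (y gM12) (\<delta> x) else 0"
  show "?\<omega> \<in> Z2 V br"
    by (rule functional_wedge_derivation[OF \<delta>_C1 \<delta>_derivation]) (simp_all add: vscale_apply br_gM12)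
  show "\<tau> ?\<omega> = 1"
    by (simp add: \<tau>_def \<delta>_def vscale_apply apply_bvec)
qed

section \<open>Normalisation of a cocycle\<close>

text \<open>
  The map \<open>f\<close> preserves weights, so that its coboundary is again \<open>T\<close>-invariant, and is diagonal
  except on \<open>\<langle>D, R, M\<rangle>\<close>. Set \<open>f H = 0\<close>. Then \<open>\<omega> H = d1 f H\<close> becomes a system that can be solved
  one component at a time: the pairs \<open>(H, X\<^sub>k)\<close> give a recursion for the scalars \<open>\<phi> k\<close> of \<open>f\<close> on
  \<open>X\<^sub>k\<close>, the pairs of \<open>H\<close> with \<open>D, R, M\<close> give the \<open>D\<close>-components \<open>d\<close> of \<open>f\<close> there, and the pair
  \<open>(H, C)\<close> gives \<open>f C\<close> and the rest of \<open>f D\<close>. The \<open>R\<close>-component of \<open>f R\<close> is free for the value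
  at \<open>(R, X\<^sub>0)\<close>, and the components of \<open>f M\<close> at \<open>R\<close> and \<open>M\<close> for the value at \<open>(X\<^sub>0, Y\<^sub>n)\<close>.
\<close>
lemma invariant_cocycle_coboundary:
  assumes n3: "n \<ge> 3" and \<omega>: "\<omega> \<in> Z2 V br" and inv: "invariant T \<omega>" and \<tau>0: "\<tau> \<omega> = 0"
  shows "\<omega> \<in> B2 V br"
proof -
  note \<omega>2 = Z2_C2[OF \<omega>]
  note S = C2_simps[OF \<omega>2]
  note swap = C2_swap[OF \<omega>2]
  note weight = invariant_weight[OF \<omega>2 inv]
  define u where "u s k = \<omega> H (Xv s k) (gP (k - 1))" for s k
  define \<phi> where "\<phi> s k = - (\<Sum>j\<in>{1..k}. u s j / of_nat j)" for s k
  define d where "d y = \<omega> y H gH / 2" for y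
  define h where "h = \<omega> H C"
  define p where "p = \<omega> R (Xv \<i> 0) (gP 0)"
  define w where "w = \<omega> (Xv \<i> 0) (Xv (- \<i>) n)"
  define FD where "FD = vscale (d D) D + vscale (h gM12) R + vscale (h gM) M"
  define FR where "FR = vscale (d R) D + vscale ((p - d R * of_nat n) / \<i>) R"
  define FM where "FM = vscale (d M) D + vscale (- w gM12 / (2 * \<beta> 0)) R
    + vscale (\<phi> (- \<i>) n - w gM / (2 * \<beta> 0)) M"
  define F where "F g = (case g of gH \<Rightarrow> 0 | gD \<Rightarrow> FD | gC \<Rightarrow> vscale (d D - h gD) C
    | gM12 \<Rightarrow> FR | gM \<Rightarrow> FM | gP k \<Rightarrow> vscale (\<phi> \<i> k) (Xv \<i> k)
    | gQ k \<Rightarrow> vscale (\<phi> (- \<i>) k) (Xv (- \<i>) k))" for g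
  have FV: "FD \<in> V" "FR \<in> V" "FM \<in> V" by (simp_all add: FD_def FR_def FM_def)
  then have "F g \<in> V" if "g \<in> B" for g using that by (cases g) (simp_all add: F_def)
  then obtain f where f: "f \<in> C1 V" and fE: "\<And>g. g \<in> B \<Longrightarrow> f (E g) = F g"
    using linear_extension[of F] by blast
  have f_gen: "f H = 0" "f D = FD" "f C = vscale (d D - h gD) C" "f R = FR" "f M = FM"
    using fE[of gH] fE[of gD] fE[of gC] fE[of gM12] fE[of gM] by (simp_all add: F_def)
  have fX: "f (Xv s k) = vscale (\<phi> s k) (Xv s k)" if "k \<le> n" "s * s = -1" for s k
    using fE[of "gP k"] fE[of "gQ k"] that unfolding sqrt_minus_one by (auto simp: F_def)
  note fS = C1_simps[OF f]
  have F_weight: "br T (F g) = vscale (wt g) (F g)" if "g \<in> B" for g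
    using that brackets_T eigenvector_X
    by (cases g) (simp_all add: F_def FD_def FR_def FM_def br_simps(1-5) mult.commute vec.scale_left_diff_distrib[of _ _ C]
        vec.scale_right_diff_distrib)
  have "linear_on V (\<lambda>x. f (br T x) - br T (f x))"
    by (auto simp: linear_on_def fS br_simps(1,4) vec.scale_right_diff_distrib)
  then have comm: "f (br T x) = br T (f x)" if "x \<in> V" for x
    using linear_on_vanish[of "\<lambda>x. f (br T x) - br T (f x)"] that
    by (simp add: eigen fS fE E_in F_weight)
  define \<eta> where "\<eta> = \<omega> - d1 V br f"
  have \<eta>Z: "\<eta> \<in> Z2 V br" unfolding \<eta>_def by (intro Z2_diff \<omega> d1_Z2 f)
  have \<eta>inv: "invariant T \<eta>"
    unfolding \<eta>_def by (intro invariant_diff inv invariant_d1 f T_in comm \<omega>2 d1_C2)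
  have \<eta>: "\<eta> x y = \<omega> x y - (br x (f y) - br y (f x) - f (br x y))" if "x \<in> V" "y \<in> V" for x y
    using that by (simp add: \<eta>_def d1_def)
  note \<eta>swap = C2_swap[OF Z2_C2[OF \<eta>Z]]
  have \<eta>YH: "\<eta> Y H = 0" if Y: "Y \<in> {D, R, M}" for Y
  proof -
    have YV: "Y \<in> V" "br T Y = vscale 0 Y" using Y by (auto simp: brackets_T)
    have "br T (\<omega> Y H) = vscale 2 (\<omega> Y H)"
      using weight[of Y H 0 2] YV by (simp add: brackets_T)
    then have \<omega>Y: "\<omega> Y H = vscale (2 * d Y) H"
      using weight_H[of "\<omega> Y H"] S(1)[of Y H] YV by (simp add: d_def)
    have "br H (f Y) = vscale (- 2 * d Y) H"
      using Y by (auto simp: f_gen FD_def FR_def FM_def br_bilinear br_diff brackets_levi)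
    moreover have "f (br Y H) = 0" using Y by (auto simp: brackets_levi fS f_gen)
    ultimately show ?thesis using YV by (simp add: \<eta> \<omega>Y f_gen br_negative)
  qed
  have \<eta>HC: "\<eta> H C = 0"
  proof -
    have "br T h = 0"
      using weight[of H C 2 "-2"] by (simp add: h_def brackets_T)
    then have "h = vscale (h gD) D + vscale (h gM12) R + vscale (h gM) M"
      by (intro weight_zero) (simp_all add: h_def S)
    also have "\<dots> = br H (f C) - f (br H C)"
      by (simp add: f_gen fS brackets_levi br_bilinear br_diff FD_def algebra_simps)
    finally have "h = br H (f C) - f (br H C)" .
    then show ?thesis by (simp add: \<eta> f_gen br_negative h_def)
  qed
  have \<eta>HX: "\<eta> H (Xv s k) = 0" if k: "k \<le> n" and s: "s * s = -1" for s k
  proof -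
    have wt: "br T (\<omega> H (Xv s k)) = vscale (2 + (of_nat n - 2 * of_nat k + s)) (\<omega> H (Xv s k))"
      by (rule weight) (use k s eigenvector_X[of k s] in \<open>auto simp: brackets_T\<close>)
    have "\<omega> H (Xv s k) = vscale (- of_nat k * (\<phi> s k - \<phi> s (k - 1))) (Xv s (k - 1))"
    proof (cases k)
      case 0
      have "\<omega> H (Xv s k) = 0"
      proof (rule weight_none[OF _ wt])
        fix g show "g \<in> B \<Longrightarrow> wt g \<noteq> 2 + (of_nat n - 2 * of_nat k + s)"
          using s 0 unfolding sqrt_minus_one by (cases g) (auto simp: complex_eq_iff)
      qed (use k S in simp)
      then show ?thesis using 0 by simp
    next
      case (Suc j)
      have "\<omega> H (Xv s k) = vscale (u s k) (Xv s (k - 1))"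
        unfolding u_def
        by (rule weight_X[OF _ _ _ s]) (use k Suc S wt in \<open>auto simp: algebra_simps\<close>)
      moreover have "u s k = - of_nat k * (\<phi> s k - \<phi> s (k - 1))"
        using Suc by (simp add: \<phi>_def del: of_nat_Suc)
      ultimately show ?thesis by simp
    qed
    then show ?thesis
      using k s by (simp add: \<eta> f_gen fX fS br_negative br_bilinear brackets_X
          vec.scale_left_diff_distrib vec.scale_right_diff_distrib algebra_simps)
  qed
  have \<eta>H: "\<eta> H x = 0" if "x \<in> V" for x
  proof (rule linear_on_vanish[OF _ _ that])
    show "linear_on V (\<eta> H)" using Z2_C2[OF \<eta>Z] by (simp add: C2_def)
    fix g show "g \<in> B \<Longrightarrow> \<eta> H (E g) = 0"
      using \<eta>YH \<eta>HC \<eta>HX \<eta>swap[of H D] \<eta>swap[of H R] \<eta>swap[of H M] C2_self[OF Z2_C2[OF \<eta>Z], of H]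
      by (cases g) simp_all
  qed
  have \<phi>0: "\<phi> s 0 = 0" for s by (simp add: \<phi>_def)
  have RX: "\<eta> R (Xv \<i> 0) = 0"
  proof -
    have "br T (\<omega> R (Xv \<i> 0)) = vscale (of_nat n - 2 * of_nat 0 + \<i>) (\<omega> R (Xv \<i> 0))"
      using weight[of R "Xv \<i> 0" 0 "of_nat n + \<i>"] eigenvector_X[of 0 \<i>] by (simp add: brackets_T)
    from weight_X[OF _ this] have 1: "\<omega> R (Xv \<i> 0) = vscale p (Xv \<i> 0)"
      by (simp add: S p_def)
    have 2: "br (Xv \<i> 0) FR = vscale (- p) (Xv \<i> 0)"
      unfolding FR_def br_bilinear
      by (simp add: brackets_X' flip: vec.scale_left_diff_distrib vec.scale_minus_left
          vec.scale_left_distrib) (simp add: algebra_simps)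
    show ?thesis
      by (simp add: \<eta> 1 2 f_gen fX \<phi>0 fS brackets_X br_negative)
  qed
  have *: "\<eta> (Xv \<i> 0) (Xv (- \<i>) n) = w - vscale (2 * \<beta> 0 * \<phi> (- \<i>) n) M + vscale (2 * \<beta> 0) FM"
    by (simp add: \<eta> w_def fX \<phi>0 br_bilinear br_negative brackets_XX fS f_gen mult.commute)
  have XX: "\<eta> (Xv \<i> 0) (Xv (- \<i>) n) gM12 = 0" "\<eta> (Xv \<i> 0) (Xv (- \<i>) n) gM = 0"
    unfolding * FM_def by (simp_all add: vscale_apply apply_bvec \<beta>_nonzero algebra_simps)
  have RM: "\<eta> R M gM = 0"
    using \<tau>0 \<tau>_d1[OF f] by (simp add: \<eta>_def \<tau>_def)
  have "\<eta> x y = 0" if "x \<in> V" "y \<in> V" for x y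
    by (rule normalised_cocycle_vanishes[OF n3 \<eta>Z \<eta>inv _ RX XX RM that]) (rule \<eta>H)
  then have "\<omega> x y = d1 V br f x y" if "x \<in> V" "y \<in> V" for x y
    using that by (simp add: \<eta>_def)
  then have "\<omega> = d1 V br f"
    by (rule C2_ext[OF \<omega>2 d1_C2[OF f]])
  then show ?thesis using f by (simp add: B2_def)
qed

theorem kernel_\<tau>:
  assumes n3: "n \<ge> 3" and \<omega>: "\<omega> \<in> Z2 V br"
  shows "\<tau> \<omega> = 0 \<longleftrightarrow> \<omega> \<in> B2 V br"
proof
  assume 0: "\<tau> \<omega> = 0"
  from cohomologous_invariant[OF \<omega>] obtain f where f: "f \<in> C1 V" "invariant T (\<omega> - d1 V br f)" .
  have "\<tau> (\<omega> - d1 V br f) = 0" using 0 \<tau>_d1[OF f(1)] by (simp add: \<tau>_def)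
  with f have "\<omega> - d1 V br f \<in> B2 V br"
    by (intro invariant_cocycle_coboundary n3 Z2_diff \<omega> d1_Z2)
  moreover have "d1 V br f \<in> B2 V br" using f by (simp add: B2_def)
  ultimately have "(\<omega> - d1 V br f) + d1 V br f \<in> B2 V br" by (rule B2_add)
  then show "\<omega> \<in> B2 V br" by (simp only: diff_add_cancel)
qed (use \<tau>_d1 in \<open>auto simp: B2_def\<close>)

end

section \<open>The second cohomology space\<close>

theorem theorem5p3:
  fixes l :: real
  assumes "\<exists>n::nat. l = 1/2 + real n" and "l \<ge> 3/2"
  shows "linear_isomorphic
           (H2 (cga_hat l) (cga_bracket l)) (H2_scale (cga_hat l) (cga_bracket l))
           (UNIV :: complex set) (*)"
proof -
  from assms(1) obtain N :: nat where N: "l = 1/2 + real N" by blast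
  then interpret galilei l "2 * N + 1" N by unfold_locales simp_all
  have n3: "2 * N + 1 \<ge> 3" using assms(2) N by simp
  obtain \<omega> where "\<omega> \<in> Z2 (cga_hat l) (cga_bracket l)" "\<tau> \<omega> = 1" by (rule witness)
  then show ?thesis
    using H2_one_dimensional[of \<tau>, OF _ _ kernel_\<tau>[OF n3]] by (simp add: \<tau>_def vscale_apply)
qed

end
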